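(* Let $(c_L,c_M,h_L,h_M)\in\mathbb C^4$ with $c_M\ne0$ and $2h_M+\frac{p^2-1}{12}c_M=0$ for some $p\in\mathbb Z_+$. Then any singular vector of the Verma module $V_{W(2,2)}(h_L,h_M,c_L,c_M)$ over $W(2,2)$ is, up to a scalar multiple, $\mathrm S^k\mathbf 1$ for some $k\in\mathbb N$.
   Context: $W(2,2)$ is the complex Lie algebra with basis $L_n,M_n$ ($n\in\mathbb Z$), $\mathbf c_L,\mathbf c_M$ and brackets $[L_m,L_n]=(m-n)L_{m+n}+\frac1{12}\delta_{m+n,0}(m^3-m)\mathbf c_L$, $[L_m,M_n]=(m-n)M_{m+n}+\frac1{12}\delta_{m+n,0}(m^3-m)\mathbf c_M$, $[M_m,M_n]=0$, with $\mathbf c_L,\mathbf c_M$ central. $V_{W(2,2)}(h_L,h_M,c_L,c_M)$ is the Verma module generated freely over the negative part by a highest weight vector $\mathbf 1$ annihilated by all $L_n,M_n$ with $n>0$, on which $\mathbf c_L,\mathbf c_M,L_0,M_0$ act by $c_L,c_M,h_L,h_M$. A singular vector is a nonzero common eigenvector of $L_0,M_0,\mathbf c_L,\mathbf c_M$ annihilated by all $L_n,M_n$ with $n>0$. $\mathbb N=\{0,1,2,\dots\}$, $\mathbb Z_+=\{1,2,\dots\}$. $\mathrm S$ is the unique polynomial in the $M_{-i}$ ($i\ge1$) of the form $M_{-p}+\sum_\mu s_\mu M_{-\mu}$ (sum over partitions $\mu=(\mu_1,\dots,\mu_k)\neq(p)$ of $p$, $M_{-\mu}=M_{-\mu_1}\cdots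 M_{-\mu_k}$, $s_\mu\in\mathbb C$) such that $\mathrm S\mathbf 1$ is a singular vector; it depends only on $p,c_M$. *)

theory Defs
  imports Complex_Main
begin

definition is_partition :: "nat list \<Rightarrow> bool" where
  "is_partition \<mu> \<longleftrightarrow> sorted_wrt (\<ge>) \<mu> \<and> (\<forall>i\<in>set \<mu>. 1 \<le> i)"

definition partitions_of :: "nat \<Rightarrow> nat list set" where
  "partitions_of p = {\<mu>. is_partition \<mu> \<and> sum_list \<mu> = p}"

lemma finite_partitions_of: "finite (partitions_of p)"
proof (rule finite_subset)
  have len: "length \<mu> \<le> sum_list \<mu>" if "\<forall>i\<in>set \<mu>. 1 \<le> i" for \<mu> :: "nat list"
    using that by (induction \<mu>) auto
  have mem: "i \<le> sum_list \<mu>" if "i \<in> set \<mu>" for i and \<mu> :: "nat list"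
    using that by (rule member_le_sum_list) simp
  show "partitions_of p \<subseteq> {\<mu>. set \<mu> \<subseteq> {..p} \<and> length \<mu> \<le> p}"
    using len mem by (auto simp: partitions_of_def is_partition_def)
  show "finite {\<mu>. set \<mu> \<subseteq> {..p} \<and> length \<mu> \<le> p}"
    by (rule finite_lists_length_le) simp
qed

text \<open>
  A module over $W(2,2)$ is a complex vector space with linear operators by which the basis
  elements $L_n$, $M_n$, $\mathbf c_L$, $\mathbf c_M$ act. Since these elements are a basis, being
  a representation means that the operators satisfy the commutation relations of the basis.
\<close>

locale W22_module = vector_space scale
  for scale :: "complex \<Rightarrow> 'v::ab_group_add \<Rightarrow> 'v" +
  fixes L M :: "int \<Rightarrow> 'v \<Rightarrow> 'v" and CL CM :: "'v \<Rightarrow> 'v"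
  assumes linear_L: "Vector_Spaces.linear scale scale (L n)"
    and linear_M: "Vector_Spaces.linear scale scale (M n)"
    and linear_CL: "Vector_Spaces.linear scale scale CL"
    and linear_CM: "Vector_Spaces.linear scale scale CM"
    and bracket_LL: "L m (L n v) - L n (L m v) =
      scale (of_int (m - n)) (L (m + n) v)
      + (if m + n = 0 then scale (of_int (m ^ 3 - m) / 12) (CL v) else 0)"
    and bracket_LM: "L m (M n v) - M n (L m v) =
      scale (of_int (m - n)) (M (m + n) v)
      + (if m + n = 0 then scale (of_int (m ^ 3 - m) / 12) (CM v) else 0)"
    and bracket_MM: "M m (M n v) - M n (M m v) = 0"
    and central_CL_L: "CL (L n v) = L n (CL v)"
    and central_CL_M: "CL (M n v) = M n (CL v)"
    and central_CM_L: "CM (L n v) = L n (CM v)"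
    and central_CM_M: "CM (M n v) = M n (CM v)"
    and central_CL_CM: "CL (CM v) = CM (CL v)"
begin

definition singular_vector :: "'v \<Rightarrow> bool" where
  "singular_vector v \<longleftrightarrow> v \<noteq> 0
     \<and> (\<exists>a. L 0 v = scale a v) \<and> (\<exists>a. M 0 v = scale a v)
     \<and> (\<exists>a. CL v = scale a v) \<and> (\<exists>a. CM v = scale a v)
     \<and> (\<forall>n>0. L n v = 0 \<and> M n v = 0)"

definition L_mono :: "nat list \<Rightarrow> 'v \<Rightarrow> 'v" where
  "L_mono \<nu> v = foldr (\<lambda>i. L (- int i)) \<nu> v"

definition M_mono :: "nat list \<Rightarrow> 'v \<Rightarrow> 'v" where
  "M_mono \<mu> v = foldr (\<lambda>i. M (- int i)) \<mu> v"

definition M_poly :: "nat \<Rightarrow> (nat list \<Rightarrow> complex) \<Rightarrow> 'v \<Rightarrow> 'v" where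
  "M_poly p s v = (\<Sum>\<mu>\<in>partitions_of p. scale (s \<mu>) (M_mono \<mu> v))"

end

text \<open>
  The Verma module. By the Poincare-Birkhoff-Witt theorem the ordered monomials
  $M_{-\mu} L_{-\nu}$, indexed by pairs of partitions, form a basis of the enveloping algebra
  of the negative part; that the module is freely generated over it by \<open>one\<close> means that
  $(\mu, \nu) \mapsto M_{-\mu} L_{-\nu} \mathbf 1$ is a basis (as a family, hence the
  injectivity).
\<close>

locale W22_Verma = W22_module scale L M CL CM
  for scale :: "complex \<Rightarrow> 'v::ab_group_add \<Rightarrow> 'v"
    and L M :: "int \<Rightarrow> 'v \<Rightarrow> 'v" and CL CM :: "'v \<Rightarrow> 'v" +
  fixes hL hM cL cM :: complex and one :: 'v
  assumes L_pos: "n > 0 \<Longrightarrow> L n one = 0"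
    and M_pos: "n > 0 \<Longrightarrow> M n one = 0"
    and L_zero: "L 0 one = scale hL one"
    and M_zero: "M 0 one = scale hM one"
    and CL_one: "CL one = scale cL one"
    and CM_one: "CM one = scale cM one"
    and PBW_inj: "inj_on (\<lambda>(\<mu>, \<nu>). M_mono \<mu> (L_mono \<nu> one))
      (Collect is_partition \<times> Collect is_partition)"
    and PBW_independent: "independent ((\<lambda>(\<mu>, \<nu>). M_mono \<mu> (L_mono \<nu> one)) `
      (Collect is_partition \<times> Collect is_partition))"
    and PBW_span: "span ((\<lambda>(\<mu>, \<nu>). M_mono \<mu> (L_mono \<nu> one)) `
      (Collect is_partition \<times> Collect is_partition)) = UNIV"
begin

text \<open>
  A polynomial of weight $p$ in the commuting $M_{-i}$ is given by its coefficients, a function on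
  partitions that vanishes off the partitions of $p$.
\<close>

definition S_coeff :: "nat \<Rightarrow> nat list \<Rightarrow> complex" where
  "S_coeff p = (THE s. (\<forall>\<mu>. \<mu> \<notin> partitions_of p \<longrightarrow> s \<mu> = 0) \<and> s [p] = 1
     \<and> singular_vector (M_poly p s one))"

definition S :: "nat \<Rightarrow> 'v \<Rightarrow> 'v" where
  "S p = M_poly p (S_coeff p)"

end

end

theory Submission
  imports Defs "HOL-Library.Multiset"
begin

text \<open>
  Two brackets with the same structure constants carry the proof:
  \<open>[M n, L (-j)] = (n + j) M (n - j) + central\<close> and \<open>[L n, M (-j)] = (n + j) M (n - j) + central\<close>.
  By the first, \<open>M n\<close> with \<open>n \<ge> 0\<close> (minus its eigenvalue \<open>hM\<close> for \<open>n = 0\<close>) acts on the terms of a vector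
  with the largest number of factors \<open>L\<close> as the first-order operator
  \<open>(\<Sum>j>n. (n + j) M (n - j) \<partial>/\<partial>L (-j)) + diag_coeff n \<partial>/\<partial>L (-n)\<close>. By the second, \<open>L n\<close> acts on the
  polynomials in the commuting \<open>M (-j)\<close> by the same formula with \<open>\<partial>/\<partial>M (-j)\<close> in place of \<open>\<partial>/\<partial>L (-j)\<close>
  (plus the scalar \<open>hL\<close> for \<open>n = 0\<close>).

  The hypothesis on \<open>hM\<close> makes \<open>diag_coeff n\<close> a nonzero multiple of \<open>n (n\<^sup>2 - p\<^sup>2)\<close>. So the equations for
  \<open>n \<ge> 1\<close> form a triangular system whose solutions are \<open>b j = grad_S j (b p)\<close> with \<open>b p\<close> free
  (\<open>row_kernel\<close>). On these solutions the operator with \<open>n = 0\<close> becomes \<open>pS (b p)\<close>, where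
  \<open>pS = (\<Sum>j. j M (-j) grad_S j)\<close> is \<open>p M (-p)\<close> plus a polynomial in the \<open>M (-i)\<close> with \<open>i < p\<close>. Since
  \<open>[\<partial>/\<partial>M (-p), pS] = p\<close>, multiplication by \<open>pS\<close> is injective (\<open>pS_reflects_stable\<close>).

  This settles the theorem in three steps. Suppose a singular vector has a term with \<open>d > 0\<close> factors \<open>L\<close>, and
  take the leading part. The equations for \<open>M n\<close>, \<open>n \<ge> 0\<close>, show that \<open>pS\<close> annihilates its derivative with
  respect to \<open>L (-p)\<close>. So this derivative, and with it all \<open>L\<close>-derivatives of the leading part, vanish,
  which is absurd; a singular vector is therefore a polynomial in the \<open>M\<close>s (\<open>singular_has_no_L\<close>). Next, a direct computation shows that \<open>pS one\<close> is singular, and since a solution is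
  determined by its derivative with respect to \<open>M (-p)\<close>, the polynomial \<open>S\<close> exists, is unique and is \<open>pS / p\<close>
  (\<open>S_eq\<close>). Finally, for a singular polynomial \<open>v\<close> with \<open>L 0 v = a v\<close> the equation for \<open>L 0\<close> reads
  \<open>(a - hL) v = pS (\<partial>v/\<partial>M (-p))\<close>, and \<open>\<partial>v/\<partial>M (-p)\<close> solves the same equations. Repeated differentiation
  ends in a constant, so \<open>v\<close> is a multiple of a power of \<open>S\<close> (\<open>kernel_is_power\<close>).

  Polynomials in the \<open>M (-i)\<close> are never formed as a ring: they are operators on the module, and their
  derivatives are linear maps defined on the PBW basis.
\<close>

section \<open>Linear operators and commutation rules\<close>

context W22_module
begin

abbreviation lin :: "('v \<Rightarrow> 'v) \<Rightarrow> bool" where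
  "lin \<equiv> Vector_Spaces.linear scale scale"

lemma lin_iff: "lin f \<longleftrightarrow> (\<forall>x y. f (x + y) = f x + f y) \<and> (\<forall>c x. f (scale c x) = scale c (f x))"
  by (auto simp: Vector_Spaces.linear_iff vector_space_axioms)

lemma lin_rules:
  assumes "lin f"
  shows "f (x + y) = f x + f y" "f (scale c x) = scale c (f x)" "f 0 = 0"
    "f (- x) = - f x" "f (x - y) = f x - f y" "f (sum g A) = (\<Sum>a\<in>A. f (g a))"
proof -
  interpret f: Vector_Spaces.linear scale scale f by fact
  show "f (x + y) = f x + f y" "f (scale c x) = scale c (f x)" "f 0 = 0"
    "f (- x) = - f x" "f (x - y) = f x - f y" "f (sum g A) = (\<Sum>a\<in>A. f (g a))"
    by (simp_all add: f.add f.scale f.neg f.diff f.sum)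
qed

lemmas act_simps = lin_rules[OF linear_L] lin_rules[OF linear_M]

lemma lin_compose: "lin f \<Longrightarrow> lin g \<Longrightarrow> lin (\<lambda>x. f (g x))"
  by (simp add: lin_iff)

lemma lin_add: "lin f \<Longrightarrow> lin g \<Longrightarrow> lin (\<lambda>x. f x + g x)"
  by (simp add: lin_iff scale_right_distrib)

lemma lin_diff: "lin f \<Longrightarrow> lin g \<Longrightarrow> lin (\<lambda>x. f x - g x)"
  by (simp add: lin_iff scale_right_diff_distrib)

lemma lin_scale: "lin f \<Longrightarrow> lin (\<lambda>x. scale c (f x))"
  by (simp add: lin_iff scale_right_distrib mult.commute)

lemma lin_zero: "lin (\<lambda>x. 0)" and lin_ident: "lin (\<lambda>x. x)"
  by (simp_all add: lin_iff)

lemma lin_sum: "(\<And>i. i \<in> I \<Longrightarrow> lin (f i)) \<Longrightarrow> lin (\<lambda>x. \<Sum>i\<in>I. f i x)"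
  by (induction I rule: infinite_finite_induct) (auto intro: lin_add lin_zero)

lemma lin_funpow: "lin f \<Longrightarrow> lin (f ^^ k)"
  by (induction k) (simp_all add: lin_iff)

lemmas lin_intros = lin_add lin_diff lin_scale lin_zero lin_ident lin_sum

lemma lin_span_in:
  assumes "lin f" "subspace Z" "\<And>b. b \<in> X \<Longrightarrow> f b \<in> Z" "x \<in> span X"
  shows "f x \<in> Z"
proof -
  interpret f: Vector_Spaces.linear scale scale f by fact
  from assms(4) show ?thesis
  proof (induction rule: span_induct)
    case base
    show ?case using f.subspace_vimage[OF assms(2)] by (simp add: vimage_def)
  qed (simp add: assms(3))
qed

lemma M_commute: "M a (M b v) = M b (M a v)"
  using bracket_MM[of a b v] by simp

lemma L_M: "L m (M n v) = M n (L m v) + scale (of_int (m - n)) (M (m + n) v)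
      + (if m + n = 0 then scale (of_int (m ^ 3 - m) / 12) (CM v) else 0)"
  using bracket_LM[of m n v] by (simp add: algebra_simps)

lemma M_L: "M n (L m v) = L m (M n v) - scale (of_int (m - n)) (M (m + n) v)
      - (if m + n = 0 then scale (of_int (m ^ 3 - m) / 12) (CM v) else 0)"
  using bracket_LM[of m n v] by (simp add: algebra_simps)

text \<open>
  Creating with \<open>L (-m)\<close> and then acting by \<open>M a\<close>: the form of the bracket in which the
  central term carries the sign with which it enters all later computations.
\<close>

lemma M_L_neg: "M a (L (- int m) v) = L (- int m) (M a v) + scale (of_int (int m + a)) (M (a - int m) v)
      + (if a = int m then scale ((of_nat m ^ 3 - of_nat m) / 12) (CM v) else 0)"
proof -
  have "of_int (- int m - a) = - (of_int (int m + a) :: complex)"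
    by simp
  moreover have "of_int ((- int m) ^ 3 - (- int m)) = - (of_nat m ^ 3 - of_nat m :: complex)"
    by simp
  then have "of_int ((- int m) ^ 3 - (- int m)) / 12 = - ((of_nat m ^ 3 - of_nat m) / 12 :: complex)"
    by (simp only: minus_divide_left)
  ultimately show ?thesis
    unfolding M_L by (simp only: scale_minus_left) (auto simp: algebra_simps)
qed

lemma M_mono_simps [simp]: "M_mono [] v = v" "M_mono (i # \<mu>) v = M (- int i) (M_mono \<mu> v)"
  by (simp_all add: M_mono_def)

lemma L_mono_simps [simp]: "L_mono [] v = v" "L_mono (i # \<mu>) v = L (- int i) (L_mono \<mu> v)"
  by (simp_all add: L_mono_def)

lemma lin_M_mono: "lin (M_mono \<mu>)"
  by (induction \<mu>) (simp_all add: lin_iff act_simps)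

lemma M_M_mono: "M a (M_mono \<mu> v) = M_mono \<mu> (M a v)"
proof (induction \<mu>)
  case (Cons i \<mu>)
  show ?case using M_commute[of a "- int i"] Cons by simp
qed simp

lemma M_mono_append: "M_mono (\<mu> @ \<nu>) v = M_mono \<mu> (M_mono \<nu> v)"
  by (induction \<mu>) simp_all

lemma M_mono_perm: "mset \<mu> = mset \<nu> \<Longrightarrow> M_mono \<mu> v = M_mono \<nu> v"
proof (induction \<mu> arbitrary: \<nu>)
  case (Cons i \<mu>)
  then have "i \<in> set \<nu>" by (metis list.set_intros(1) set_mset_mset)
  then obtain xs ys where \<nu>: "\<nu> = xs @ i # ys" by (auto simp: in_set_conv_decomp)
  with Cons.prems have "mset \<mu> = mset (xs @ ys)" by simp
  from Cons.IH[OF this] show ?case by (simp add: \<nu> M_mono_append M_M_mono)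
qed simp

end

section \<open>The basis of the Verma module, indexed by pairs of multisets\<close>

definition dsort :: "nat multiset \<Rightarrow> nat list" where
  "dsort A = rev (sorted_list_of_multiset A)"

lemma mset_dsort [simp]: "mset (dsort A) = A"
  by (simp add: dsort_def)

lemma set_dsort [simp]: "set (dsort A) = set_mset A"
  by (metis mset_dsort set_mset_mset)

lemma sorted_dsort: "sorted_wrt (\<ge>) (dsort A)"
  by (simp add: dsort_def sorted_wrt_rev sorted_sorted_list_of_multiset)

lemma dsort_mset: "sorted_wrt (\<ge>) \<mu> \<Longrightarrow> dsort (mset \<mu>) = \<mu>"
proof -
  assume "sorted_wrt (\<ge>) \<mu>"
  then have "sorted (rev \<mu>)" by (simp add: sorted_wrt_rev)
  then have "sort \<mu> = rev \<mu>" by (intro properties_for_sort) simp_all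
  then show ?thesis by (simp add: dsort_def)
qed

lemma dsort_add_mset_max: "\<forall>i\<in>#N. i \<le> k \<Longrightarrow> dsort (add_mset k N) = k # dsort N"
proof -
  assume "\<forall>i\<in>#N. i \<le> k"
  then have "sorted_wrt (\<ge>) (k # dsort N)" using sorted_dsort[of N] by auto
  from dsort_mset[OF this] show ?thesis by simp
qed

lemma is_partition_dsort: "is_partition (dsort A) \<longleftrightarrow> 0 \<notin># A"
  by (auto simp: is_partition_def sorted_dsort Suc_le_eq intro: gr0I)

lemma pos_diff: "0 \<notin># A \<Longrightarrow> 0 \<notin># A - X"
  by (meson in_diffD)

lemma pos_mem: "0 \<notin># A \<Longrightarrow> i \<in># A \<Longrightarrow> Suc 0 \<le> i"
  by (cases i) auto

lemma mem_le_sum_mset: "i \<in># A \<Longrightarrow> i \<le> sum_mset A" for A :: "nat multiset"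
  by (auto dest!: multi_member_split)

lemma dsort_empty [simp]: "dsort {#} = []"
  by (simp add: dsort_def)

context W22_Verma
begin

text \<open>
  A basis vector depends only on the multisets of the indices of the \<open>M\<close>s and of the \<open>L\<close>s; the
  decreasing order of the PBW basis matters only for the \<open>L\<close>s, which do not commute.
\<close>

definition pbw :: "nat multiset \<Rightarrow> nat multiset \<Rightarrow> 'v" where
  "pbw A N = M_mono (dsort A) (L_mono (dsort N) one)"

text \<open>
  All subspaces used below are spanned by part of the basis, so they are given by the
  property \<open>Q\<close> of the pairs of multisets that are kept.
\<close>

definition pbw_span :: "(nat multiset \<Rightarrow> nat multiset \<Rightarrow> bool) \<Rightarrow> 'v set" where
  "pbw_span Q = span {pbw A N | A N. 0 \<notin># A \<and> 0 \<notin># N \<and> Q A N}"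

lemma pbw_empty [simp]: "pbw {#} {#} = one"
  by (simp add: pbw_def)

lemma basis_eq:
  "{pbw A N | A N. 0 \<notin># A \<and> 0 \<notin># N} = (\<lambda>(\<mu>, \<nu>). M_mono \<mu> (L_mono \<nu> one)) `
      (Collect is_partition \<times> Collect is_partition)" (is "?l = ?r")
proof
  show "?l \<subseteq> ?r"
  proof
    fix x assume "x \<in> ?l"
    then obtain A N where "0 \<notin># A" "0 \<notin># N" "x = pbw A N" by blast
    then show "x \<in> ?r"
      by (intro image_eqI[where x="(dsort A, dsort N)"]) (auto simp: pbw_def is_partition_dsort)
  qed
  show "?r \<subseteq> ?l"
  proof clarify
    fix \<mu> \<nu> assume *: "is_partition \<mu>" "is_partition \<nu>"
    then have "dsort (mset \<mu>) = \<mu>" "dsort (mset \<nu>) = \<nu>"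
      by (simp_all add: is_partition_def dsort_mset)
    with * show "\<exists>A N. M_mono \<mu> (L_mono \<nu> one) = pbw A N \<and> 0 \<notin># A \<and> 0 \<notin># N"
      by (intro exI[of _ "mset \<mu>"] exI[of _ "mset \<nu>"]) (auto simp: pbw_def is_partition_def)
  qed
qed

lemma pbw_inject:
  assumes "0 \<notin># A" "0 \<notin># N" "0 \<notin># A'" "0 \<notin># N'" "pbw A N = pbw A' N'"
  shows "A = A' \<and> N = N'"
proof -
  have "(dsort A, dsort N) = (dsort A', dsort N')"
    using assms by (intro inj_onD[OF PBW_inj]) (auto simp: pbw_def is_partition_dsort)
  then show ?thesis by (metis mset_dsort prod.inject)
qed

lemma pbw_span_UNIV: "pbw_span (\<lambda>A N. True) = UNIV"
  using PBW_span basis_eq by (simp add: pbw_span_def)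

lemma subspace_pbw_span [simp]: "subspace (pbw_span Q)"
  by (simp add: pbw_span_def)

lemma pbw_in_span: "0 \<notin># A \<Longrightarrow> 0 \<notin># N \<Longrightarrow> Q A N \<Longrightarrow> pbw A N \<in> pbw_span Q"
  unfolding pbw_span_def by (intro span_base) blast

lemma pbw_span_mono: "(\<And>A N. 0 \<notin># A \<Longrightarrow> 0 \<notin># N \<Longrightarrow> Q A N \<Longrightarrow> Q' A N) \<Longrightarrow> pbw_span Q \<subseteq> pbw_span Q'"
  unfolding pbw_span_def by (intro span_mono) blast

lemma pbw_span_lin_in:
  assumes "lin f" "subspace Z"
    and "\<And>A N. 0 \<notin># A \<Longrightarrow> 0 \<notin># N \<Longrightarrow> Q A N \<Longrightarrow> f (pbw A N) \<in> Z"
    and "x \<in> pbw_span Q"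
  shows "f x \<in> Z"
  by (rule lin_span_in[OF assms(1,2) _ assms(4)[unfolded pbw_span_def]]) (use assms(3) in blast)

lemma pbw_span_lin_eq:
  assumes "lin f" "lin g"
    and "\<And>A N. 0 \<notin># A \<Longrightarrow> 0 \<notin># N \<Longrightarrow> Q A N \<Longrightarrow> f (pbw A N) = g (pbw A N)"
    and "x \<in> pbw_span Q"
  shows "f x = g x"
proof -
  have "f x - g x \<in> {0}"
    by (rule pbw_span_lin_in[OF lin_diff[OF assms(1,2)] _ _ assms(4)]) (simp_all add: assms(3))
  then show ?thesis by simp
qed

lemma lin_eq:
  assumes "lin f" "lin g"
    and "\<And>A N. 0 \<notin># A \<Longrightarrow> 0 \<notin># N \<Longrightarrow> f (pbw A N) = g (pbw A N)"
  shows "f x = g x"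
  by (rule pbw_span_lin_eq[OF assms(1,2), of "\<lambda>A N. True"]) (simp_all add: assms(3) pbw_span_UNIV)

text \<open>
  A vector is a finite combination of basis vectors, so any numerical quantity is bounded on its
  support. This supplies the upper ends of the sums over derivatives below.
\<close>

lemma pbw_span_bounded:
  fixes \<phi> :: "nat multiset \<Rightarrow> nat multiset \<Rightarrow> nat"
  assumes "x \<in> pbw_span Q"
  obtains J where "x \<in> pbw_span (\<lambda>A N. Q A N \<and> \<phi> A N \<le> J)"
proof -
  have mono: "pbw_span (\<lambda>A N. Q A N \<and> \<phi> A N \<le> J) \<subseteq> pbw_span (\<lambda>A N. Q A N \<and> \<phi> A N \<le> J')" if "J \<le> J'" for J J'
    using that by (intro pbw_span_mono) auto
  let ?U = "{x. \<exists>J. x \<in> pbw_span (\<lambda>A N. Q A N \<and> \<phi> A N \<le> J)}"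
  have "subspace ?U"
  proof (rule subspaceI)
    show "0 \<in> ?U" using subspace_0[OF subspace_pbw_span] by blast
    show "scale c x \<in> ?U" if "x \<in> ?U" for c x
      using that subspace_scale[OF subspace_pbw_span] by blast
    fix x y assume "x \<in> ?U" "y \<in> ?U"
    then obtain J J' where "x \<in> pbw_span (\<lambda>A N. Q A N \<and> \<phi> A N \<le> J)" "y \<in> pbw_span (\<lambda>A N. Q A N \<and> \<phi> A N \<le> J')"
      by blast
    then have "x \<in> pbw_span (\<lambda>A N. Q A N \<and> \<phi> A N \<le> max J J')" "y \<in> pbw_span (\<lambda>A N. Q A N \<and> \<phi> A N \<le> max J J')"
      using mono[of J "max J J'"] mono[of J' "max J J'"] by auto
    then show "x + y \<in> ?U" using subspace_add[OF subspace_pbw_span] by blast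
  qed
  with lin_ident have "x \<in> ?U"
  proof (rule pbw_span_lin_in)
    show "x \<in> pbw_span Q" by fact
  next
    fix A N assume "0 \<notin># A" "0 \<notin># N" "Q A N"
    then have "pbw A N \<in> pbw_span (\<lambda>A' N'. Q A' N' \<and> \<phi> A' N' \<le> \<phi> A N)" by (intro pbw_in_span) auto
    then show "pbw A N \<in> ?U" by blast
  qed
  then show ?thesis using that by blast
qed

text \<open>
  The source of the formal derivatives and of coefficient functionals.
\<close>

lemma lin_extend: "\<exists>g. lin g \<and> (\<forall>A N. 0 \<notin># A \<longrightarrow> 0 \<notin># N \<longrightarrow> g (pbw A N) = f A N)"
proof -
  let ?X = "{pbw A N | A N. 0 \<notin># A \<and> 0 \<notin># N}"
  let ?h = "\<lambda>x. THE y. \<exists>A N. 0 \<notin># A \<and> 0 \<notin># N \<and> x = pbw A N \<and> y = f A N"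
  interpret vector_space_pair scale scale by unfold_locales
  have "independent ?X" using PBW_independent basis_eq by simp
  from linear_independent_extend[OF this, of ?h]
  obtain g where g: "lin g" "\<forall>x\<in>?X. g x = ?h x" by blast
  have "g (pbw A N) = f A N" if "0 \<notin># A" "0 \<notin># N" for A N
  proof -
    have "?h (pbw A N) = f A N"
    proof (rule the_equality)
      show "\<exists>A' N'. 0 \<notin># A' \<and> 0 \<notin># N' \<and> pbw A N = pbw A' N' \<and> f A N = f A' N'"
        using that by blast
      show "y = f A N" if "\<exists>A' N'. 0 \<notin># A' \<and> 0 \<notin># N' \<and> pbw A N = pbw A' N' \<and> y = f A' N'" for y
        using that pbw_inject[OF \<open>0 \<notin># A\<close> \<open>0 \<notin># N\<close>] by metis
    qed
    moreover have "pbw A N \<in> ?X" using that by blast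
    ultimately show ?thesis using g(2) by simp
  qed
  with g(1) show ?thesis by blast
qed

lemma M_pbw: "M (- int i) (pbw A N) = pbw (add_mset i A) N"
proof -
  have "M (- int i) (pbw A N) = M_mono (i # dsort A) (L_mono (dsort N) one)" by (simp add: pbw_def)
  also have "\<dots> = pbw (add_mset i A) N" unfolding pbw_def by (rule M_mono_perm) simp
  finally show ?thesis .
qed

lemma L_pbw_max: "\<forall>i\<in>#N. i \<le> k \<Longrightarrow> L (- int k) (pbw {#} N) = pbw {#} (add_mset k N)"
  by (simp add: pbw_def dsort_add_mset_max)

text \<open>
  The partial derivatives with respect to \<open>M (-j)\<close> and \<open>L (-j)\<close> on the module read as the space
  of polynomials in these symbols. They are chosen as linear maps with prescribed values on the basis.
\<close>

definition deriv_M :: "nat \<Rightarrow> 'v \<Rightarrow> 'v" where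
  "deriv_M j = (SOME g. lin g \<and> (\<forall>A N. 0 \<notin># A \<longrightarrow> 0 \<notin># N \<longrightarrow>
     g (pbw A N) = scale (of_nat (count A j)) (pbw (A - {#j#}) N)))"

definition deriv_L :: "nat \<Rightarrow> 'v \<Rightarrow> 'v" where
  "deriv_L j = (SOME g. lin g \<and> (\<forall>A N. 0 \<notin># A \<longrightarrow> 0 \<notin># N \<longrightarrow>
     g (pbw A N) = scale (of_nat (count N j)) (pbw A (N - {#j#}))))"

lemma lin_deriv_M: "lin (deriv_M j)"
  and deriv_M_pbw: "0 \<notin># A \<Longrightarrow> 0 \<notin># N \<Longrightarrow> deriv_M j (pbw A N) = scale (of_nat (count A j)) (pbw (A - {#j#}) N)"
  using someI_ex[OF lin_extend[of "\<lambda>A N. scale (of_nat (count A j)) (pbw (A - {#j#}) N)"]]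
  unfolding deriv_M_def by auto

lemma lin_deriv_L: "lin (deriv_L j)"
  and deriv_L_pbw: "0 \<notin># A \<Longrightarrow> 0 \<notin># N \<Longrightarrow> deriv_L j (pbw A N) = scale (of_nat (count N j)) (pbw A (N - {#j#}))"
  using someI_ex[OF lin_extend[of "\<lambda>A N. scale (of_nat (count N j)) (pbw A (N - {#j#}))"]]
  unfolding deriv_L_def by auto

lemmas deriv_simps = lin_rules[OF lin_deriv_M] lin_rules[OF lin_deriv_L]

lemmas lin_op_intros = lin_intros lin_compose[OF linear_L] lin_compose[OF linear_M]
  lin_compose[OF lin_deriv_M] lin_compose[OF lin_deriv_L]

text \<open>
  The product rule by a generator. It makes \<open>deriv_M j\<close> and multiplication by \<open>M (-j)\<close> a Weyl pair.
\<close>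

lemma deriv_M_M: "0 < i \<Longrightarrow> deriv_M j (M (- int i) x) = M (- int i) (deriv_M j x) + (if i = j then x else 0)"
proof (rule lin_eq[where f = "\<lambda>x. deriv_M j (M (- int i) x)"])
  show "lin (\<lambda>x. deriv_M j (M (- int i) x))" by (intro lin_op_intros)
  show "lin (\<lambda>x. M (- int i) (deriv_M j x) + (if i = j then x else 0))"
    by (cases "i = j") (simp_all add: lin_op_intros)
  fix A N :: "nat multiset" assume *: "0 \<notin># A" "0 \<notin># N" and i: "0 < i"
  show "deriv_M j (M (- int i) (pbw A N)) = M (- int i) (deriv_M j (pbw A N)) + (if i = j then pbw A N else 0)"
  proof (cases "j \<in># A")
    case True
    then have "add_mset i (A - {#j#}) = add_mset i A - {#j#}" by simp
    with True * i show ?thesis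
      by (auto simp: M_pbw deriv_M_pbw act_simps scale_left_distrib)
  next
    case False
    then have "count A j = 0" by (simp add: not_in_iff)
    with * i show ?thesis by (auto simp: M_pbw deriv_M_pbw act_simps)
  qed
qed

lemma deriv_M_commute: "deriv_M i (deriv_M j x) = deriv_M j (deriv_M i x)"
proof (rule lin_eq[where f = "\<lambda>x. deriv_M i (deriv_M j x)"])
  fix A N :: "nat multiset" assume *: "0 \<notin># A" "0 \<notin># N"
  show "deriv_M i (deriv_M j (pbw A N)) = deriv_M j (deriv_M i (pbw A N))"
  proof (cases "i = j")
    case False
    with * show ?thesis
      by (simp add: deriv_M_pbw deriv_simps pos_diff mult.commute add_mset_commute)
  qed simp
qed (intro lin_op_intros)+

lemma deriv_L_M: "0 < i \<Longrightarrow> deriv_L j (M (- int i) x) = M (- int i) (deriv_L j x)"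
  by (rule lin_eq[where f = "\<lambda>x. deriv_L j (M (- int i) x)"])
    (auto intro!: lin_op_intros simp: M_pbw deriv_L_pbw act_simps)

section \<open>The filtration by the number of factors \<open>L\<close>\<close>

text \<open>
  The vectors with fewer than \<open>e\<close> factors \<open>L\<close> in every term. An integer index avoids the truncated
  subtraction in statements such as \<open>deriv_L j ` L_filt e \<subseteq> L_filt (e - 1)\<close>.
\<close>

definition L_filt :: "int \<Rightarrow> 'v set" where
  "L_filt e = pbw_span (\<lambda>A N. int (size N) < e)"

lemma subspace_L_filt [simp]: "subspace (L_filt e)"
  by (simp add: L_filt_def)

lemmas L_filt_closed = subspace_add[OF subspace_L_filt] subspace_scale[OF subspace_L_filt]
  subspace_diff[OF subspace_L_filt] subspace_0[OF subspace_L_filt] subspace_sum[OF subspace_L_filt]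

lemma L_filt_mono: "e \<le> e' \<Longrightarrow> x \<in> L_filt e \<Longrightarrow> x \<in> L_filt e'"
  using pbw_span_mono[of "\<lambda>A N. int (size N) < e" "\<lambda>A N. int (size N) < e'"] by (auto simp: L_filt_def)

lemma pbw_in_L_filt: "0 \<notin># A \<Longrightarrow> 0 \<notin># N \<Longrightarrow> int (size N) < e \<Longrightarrow> pbw A N \<in> L_filt e"
  unfolding L_filt_def by (rule pbw_in_span)

lemma M_neg_L_filt:
  assumes "n < 0" "x \<in> L_filt e" shows "M n x \<in> L_filt e"
proof -
  define i where "i = nat (- n)"
  have n: "n = - int i" "i \<noteq> 0" using assms(1) by (auto simp: i_def)
  show ?thesis
    using assms(2) unfolding L_filt_def
    by (rule pbw_span_lin_in[OF linear_M subspace_pbw_span, rotated -1])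
      (use n(2) in \<open>auto simp: n(1) M_pbw intro: pbw_in_span\<close>)
qed

lemma M_mono_L_filt: "0 \<notin> set \<mu> \<Longrightarrow> x \<in> L_filt e \<Longrightarrow> M_mono \<mu> x \<in> L_filt e"
  by (induction \<mu>) (auto intro: M_neg_L_filt)

lemma pbw_M_mono: "pbw A N = M_mono (dsort A) (pbw {#} N)"
  by (simp add: pbw_def)

lemma deriv_L_L_filt: "x \<in> L_filt e \<Longrightarrow> deriv_L j x \<in> L_filt (e - 1)"
  unfolding L_filt_def
proof (rule pbw_span_lin_in[OF lin_deriv_L subspace_pbw_span, rotated -1])
  fix A N :: "nat multiset" assume *: "0 \<notin># A" "0 \<notin># N" "int (size N) < e"
  show "deriv_L j (pbw A N) \<in> pbw_span (\<lambda>A N. int (size N) < e - 1)"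
  proof (cases "j \<in># N")
    case True
    then have "size N > 0" by (cases N) auto
    with * True show ?thesis
      by (auto simp: deriv_L_pbw size_Diff_singleton pos_diff intro!: subspace_scale[OF subspace_pbw_span] pbw_in_span)
  next
    case False
    then have "count N j = 0" by (simp add: not_in_iff)
    with * show ?thesis by (simp add: deriv_L_pbw subspace_0[OF subspace_pbw_span])
  qed
qed

lemma deriv_M_L_filt: "x \<in> L_filt e \<Longrightarrow> deriv_M j x \<in> L_filt e"
  unfolding L_filt_def
  by (erule pbw_span_lin_in[OF lin_deriv_M subspace_pbw_span, rotated -1])
    (auto simp: deriv_M_pbw pos_diff intro!: subspace_scale[OF subspace_pbw_span] pbw_in_span)

lemma max_decompose:
  assumes "N \<noteq> {#}"
  obtains m N' where "N = add_mset m N'" "\<forall>i\<in>#N'. i \<le> (m::nat)"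
proof -
  have "Max_mset N \<in># N" using assms by simp
  then obtain N' where N': "N = add_mset (Max_mset N) N'" by (metis insert_DiffM)
  moreover have "\<forall>i\<in>#N'. i \<le> Max_mset N"
  proof
    fix i assume "i \<in># N'"
    then have "i \<in># N" by (subst N') simp
    then show "i \<le> Max_mset N" by simp
  qed
  ultimately show ?thesis by (rule that)
qed

text \<open>
  Moving \<open>L (-k)\<close> past an \<open>M\<close> only produces another \<open>M\<close>, which does not change the number of \<open>L\<close>s.
\<close>

lemma L_neg_pbw_lift:
  assumes "0 \<notin># A" "0 \<notin># N" "0 < k"
    and "L (- int k) (pbw {#} N) - pbw {#} (add_mset k N) \<in> L_filt (int (size N) + 1)"
  shows "L (- int k) (pbw A N) - pbw A (add_mset k N) \<in> L_filt (int (size N) + 1)"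
  using assms(1)
proof (induction A)
  case (add a A)
  have "L (- int k) (pbw (add_mset a A) N) - pbw (add_mset a A) (add_mset k N) =
      M (- int a) (L (- int k) (pbw A N) - pbw A (add_mset k N))
      + scale (of_int (- int k - - int a)) (M (- int k + - int a) (pbw A N))"
    unfolding M_pbw[symmetric] by (subst L_M) (use \<open>0 < k\<close> in \<open>simp add: act_simps\<close>)
  moreover have "pbw A N \<in> L_filt (int (size N) + 1)" using add.prems assms by (intro pbw_in_L_filt) auto
  ultimately show ?case using add assms(3)
    by (auto intro!: L_filt_closed M_neg_L_filt)
qed (use assms(4) in simp)

text \<open>
  Up to fewer factors \<open>L\<close>, the operator \<open>L (-k)\<close> is multiplication by a variable. If \<open>k\<close> is not
  maximal, it is exchanged with the largest factor \<open>m\<close>; the commutator merges \<open>k\<close> and \<open>m\<close> into one factor,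
  and the error terms are covered by the induction on the number of \<open>L\<close>s.
\<close>

lemma L_neg_pbw:
  assumes "0 \<notin># A" "0 \<notin># N" "0 < k"
  shows "L (- int k) (pbw A N) - pbw A (add_mset k N) \<in> L_filt (int (size N) + 1)"
  using assms
proof (induction "size N" arbitrary: A N k rule: less_induct)
  case less
  have IH_L_filt: "L (- int k) x \<in> L_filt (e + 1)" if "x \<in> L_filt e" "e \<le> int (size N)" "0 < k" for x e k
    using that(1) unfolding L_filt_def
  proof (rule pbw_span_lin_in[OF linear_L subspace_pbw_span, rotated -1], fold L_filt_def)
    fix A' N' :: "nat multiset" assume *: "0 \<notin># A'" "0 \<notin># N'" "int (size N') < e"
    have "L (- int k) (pbw A' N') - pbw A' (add_mset k N') \<in> L_filt (int (size N') + 1)"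
      using * that by (intro less.hyps) auto
    then have "L (- int k) (pbw A' N') - pbw A' (add_mset k N') \<in> L_filt (e + 1)"
      by (rule L_filt_mono[rotated]) (use * in simp)
    moreover have "pbw A' (add_mset k N') \<in> L_filt (e + 1)" using * that by (intro pbw_in_L_filt) auto
    ultimately show "L (- int k) (pbw A' N') \<in> L_filt (e + 1)" using L_filt_closed(1) by force
  qed
  show ?case
  proof (rule L_neg_pbw_lift[OF less.prems])
    show "L (- int k) (pbw {#} N) - pbw {#} (add_mset k N) \<in> L_filt (int (size N) + 1)"
    proof (cases "\<forall>i\<in>#N. i \<le> k")
      case True
      then show ?thesis by (simp add: L_pbw_max L_filt_closed)
    next
      case False
      then have "N \<noteq> {#}" by auto
      then obtain m N' where N: "N = add_mset m N'" and m: "\<forall>i\<in>#N'. i \<le> m"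
        by (rule max_decompose)
      have "k < m" using False m N by (auto simp: not_le)
      have N': "0 \<notin># N'" using less.prems N by auto
      define r where "r = L (- int k) (pbw {#} N') - pbw {#} (add_mset k N')"
      have r: "r \<in> L_filt (int (size N') + 1)"
        unfolding r_def using N N' less.prems by (intro less.hyps) auto
      have "pbw {#} N = L (- int m) (pbw {#} N')" using L_pbw_max[OF m] N by simp
      then have "L (- int k) (pbw {#} N) = L (- int m) (L (- int k) (pbw {#} N'))
          + scale (of_int (- int k - - int m)) (L (- int k + - int m) (pbw {#} N'))"
        using bracket_LL[of "- int k" "- int m" "pbw {#} N'"] \<open>k < m\<close> by (simp add: algebra_simps)
      also have "L (- int k) (pbw {#} N') = pbw {#} (add_mset k N') + r" by (simp add: r_def)
      also have "L (- int m) (\<dots>) = pbw {#} (add_mset k N) + L (- int m) r"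
        using L_pbw_max[of "add_mset k N'" m] m \<open>k < m\<close> by (simp add: act_simps N add_mset_commute)
      finally have "L (- int k) (pbw {#} N) - pbw {#} (add_mset k N) = L (- int m) r
          + scale (of_int (- int k - - int m)) (L (- int (k + m)) (pbw {#} N'))"
        by (simp add: algebra_simps)
      moreover have "L (- int m) r \<in> L_filt (int (size N') + 1 + 1)"
        using r \<open>k < m\<close> by (intro IH_L_filt) (auto simp: N)
      moreover have "L (- int (k + m)) (pbw {#} N') \<in> L_filt (int (size N') + 1 + 1)"
        using \<open>k < m\<close> N' by (intro IH_L_filt pbw_in_L_filt) (auto simp: N)
      ultimately show ?thesis by (auto simp: N intro!: L_filt_closed)
    qed
  qed
qed

lemma L_neg_L_filt:
  assumes "0 < k" "x \<in> L_filt e" shows "L (- int k) x \<in> L_filt (e + 1)"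
  using assms(2) unfolding L_filt_def
proof (rule pbw_span_lin_in[OF linear_L subspace_pbw_span, rotated -1], fold L_filt_def)
  fix A' N' :: "nat multiset" assume *: "0 \<notin># A'" "0 \<notin># N'" "int (size N') < e"
  have "L (- int k) (pbw A' N') - pbw A' (add_mset k N') \<in> L_filt (int (size N') + 1)"
    using * assms by (intro L_neg_pbw) auto
  then have "L (- int k) (pbw A' N') - pbw A' (add_mset k N') \<in> L_filt (e + 1)"
    by (rule L_filt_mono[rotated]) (use * in simp)
  moreover have "pbw A' (add_mset k N') \<in> L_filt (e + 1)" using * assms by (intro pbw_in_L_filt) auto
  ultimately show "L (- int k) (pbw A' N') \<in> L_filt (e + 1)" using L_filt_closed(1) by force
qed

lemma CM_eq: "CM x = scale cM x"
proof (rule lin_eq[where f = CM])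
  fix A N
  have L: "CM (L_mono \<nu> one) = scale cM (L_mono \<nu> one)" for \<nu>
    by (induction \<nu>) (simp_all add: CM_one central_CM_L act_simps)
  have "CM (M_mono \<mu> (L_mono \<nu> one)) = scale cM (M_mono \<mu> (L_mono \<nu> one))" for \<mu> \<nu>
    by (induction \<mu>) (simp_all add: L central_CM_M act_simps)
  then show "CM (pbw A N) = scale cM (pbw A N)" by (simp add: pbw_def)
qed (rule linear_CM, intro lin_intros)

lemma CL_eq: "CL x = scale cL x"
proof (rule lin_eq[where f = CL])
  fix A N
  have L: "CL (L_mono \<nu> one) = scale cL (L_mono \<nu> one)" for \<nu>
    by (induction \<nu>) (simp_all add: CL_one central_CL_L act_simps)
  have "CL (M_mono \<mu> (L_mono \<nu> one)) = scale cL (M_mono \<mu> (L_mono \<nu> one))" for \<mu> \<nu>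
    by (induction \<mu>) (simp_all add: L central_CL_M act_simps)
  then show "CL (pbw A N) = scale cL (pbw A N)" by (simp add: pbw_def)
qed (rule linear_CL, intro lin_intros)

text \<open>
  \<open>M j\<close> with \<open>j \<ge> 0\<close> turns an \<open>L\<close> into an \<open>M\<close> or a scalar, so it lowers the filtration, except for
  the scalar \<open>hM\<close> by which \<open>M 0\<close> acts on the highest weight vector.
\<close>

lemma M_nonneg_pbw:
  assumes "0 \<notin># A" "0 \<notin># N" "0 \<le> j"
  shows "M j (pbw A N) - (if j = 0 then scale hM (pbw A N) else 0) \<in> L_filt (int (size N))"
proof -
  have "M j (pbw {#} N) - (if j = 0 then scale hM (pbw {#} N) else 0) \<in> L_filt (int (size N))"
    using assms(2,3)
  proof (induction "size N" arbitrary: N j)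
    case 0
    then show ?case by (simp add: M_zero M_pos L_filt_closed)
  next
    case (Suc s)
    then have "N \<noteq> {#}" by auto
    then obtain m N' where N: "N = add_mset m N'" and m: "\<forall>i\<in>#N'. i \<le> m"
      by (rule max_decompose)
    have N': "0 \<notin># N'" "0 < m" "s = size N'" using Suc N by auto
    define w where "w = pbw {#} N'"
    have BN: "pbw {#} N = L (- int m) w" using L_pbw_max[OF m] N by (simp add: w_def)
    have w: "w \<in> L_filt (int (size N))" using N' by (auto simp: w_def N intro!: pbw_in_L_filt)
    have IH: "M i w - (if i = 0 then scale hM w else 0) \<in> L_filt (int (size N'))" if "0 \<le> i" for i
      unfolding w_def using Suc.hyps(1)[OF N'(3) N'(1) that] N'(3) by simp
    have Mw: "M i w \<in> L_filt (int (size N))" for i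
    proof (cases "i < 0")
      case True
      then show ?thesis using w by (rule M_neg_L_filt)
    next
      case False
      then have "M i w - (if i = 0 then scale hM w else 0) \<in> L_filt (int (size N))"
        by (intro L_filt_mono[OF _ IH]) (auto simp: N)
      moreover have "(if i = 0 then scale hM w else 0) \<in> L_filt (int (size N))"
        using w by (simp add: L_filt_closed)
      ultimately show ?thesis using L_filt_closed(1) by force
    qed
    have "L (- int m) (M j w - (if j = 0 then scale hM w else 0)) \<in> L_filt (int (size N))"
      using L_neg_L_filt[OF N'(2) IH[OF Suc.prems(2)]] by (simp add: N add.commute)
    moreover have "M j (pbw {#} N) - (if j = 0 then scale hM (pbw {#} N) else 0) =
        L (- int m) (M j w - (if j = 0 then scale hM w else 0))
        + (scale (of_int (int m + j)) (M (- int m + j) w)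
        - (if - int m + j = 0 then scale (of_int ((- int m) ^ 3 - (- int m)) / 12 * cM) w else 0))"
      unfolding BN M_L by (simp add: act_simps CM_eq algebra_simps)
    ultimately show ?case using Mw w by (auto intro!: L_filt_closed)
  qed
  then have "M_mono (dsort A) (M j (pbw {#} N) - (if j = 0 then scale hM (pbw {#} N) else 0)) \<in> L_filt (int (size N))"
    using assms(1) by (intro M_mono_L_filt) auto
  also have "M_mono (dsort A) (M j (pbw {#} N) - (if j = 0 then scale hM (pbw {#} N) else 0)) =
      M j (pbw A N) - (if j = 0 then scale hM (pbw A N) else 0)"
    by (subst (3 4) pbw_M_mono) (simp add: M_M_mono lin_rules[OF lin_M_mono])
  finally show ?thesis .
qed

lemma M_nonneg_L_filt:
  assumes "0 \<le> j" "x \<in> L_filt (e + 1)"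
  shows "M j x - (if j = 0 then scale hM x else 0) \<in> L_filt e"
  using assms(2) unfolding L_filt_def
proof (rule pbw_span_lin_in[where f = "\<lambda>x. M j x - (if j = 0 then scale hM x else 0)", rotated -1], fold L_filt_def)
  show "lin (\<lambda>x. M j x - (if j = 0 then scale hM x else 0))"
    by (cases "j = 0") (auto intro!: lin_op_intros linear_M)
  fix A N :: "nat multiset" assume *: "0 \<notin># A" "0 \<notin># N" "int (size N) < e + 1"
  show "M j (pbw A N) - (if j = 0 then scale hM (pbw A N) else 0) \<in> L_filt e"
    by (rule L_filt_mono[OF _ M_nonneg_pbw]) (use * assms in auto)
qed simp

section \<open>The positive part acts by lowering operators\<close>

text \<open>
  The scalar by which \<open>[M n, L (-n)]\<close>, and likewise \<open>[L n, M (-n)]\<close>, acts on the highest weight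
  vector.
\<close>

definition diag_coeff :: "nat \<Rightarrow> complex" where
  "diag_coeff n = 2 * of_nat n * hM + (of_nat n ^ 3 - of_nat n) / 12 * cM"

text \<open>
  The \<open>n\<close>-th row of an upper triangular system in the unknowns \<open>b j\<close>, with diagonal entries \<open>diag_coeff n\<close>.
  Since \<open>[M n, L (-j)]\<close> and \<open>[L n, M (-j)]\<close> have the same structure constants, this one operator
  describes the action of \<open>M n\<close> through the \<open>L\<close>-derivatives and that of \<open>L n\<close> through the
  \<open>M\<close>-derivatives.
\<close>

definition row :: "nat \<Rightarrow> nat \<Rightarrow> (nat \<Rightarrow> 'v) \<Rightarrow> 'v" where
  "row J n b = (\<Sum>j\<in>{n<..J}. scale (of_nat (n + j)) (M (int n - int j) (b j))) + scale (diag_coeff n) (b n)"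

lemma diag_coeff_0 [simp]: "diag_coeff 0 = 0"
  by (simp add: diag_coeff_def)

lemma row_add: "row J n (\<lambda>j. b j + c j) = row J n b + row J n c"
  by (simp add: row_def act_simps scale_right_distrib sum.distrib algebra_simps)

lemma row_diff: "row J n (\<lambda>j. b j - c j) = row J n b - row J n c"
  by (simp add: row_def act_simps scale_right_diff_distrib sum_subtractf algebra_simps)

lemma row_M: "row J n (\<lambda>j. M a (b j)) = M a (row J n b)"
  unfolding row_def act_simps by (simp add: M_commute[of a])

lemma row_single:
  "m \<le> J \<Longrightarrow> row J n (\<lambda>j. if j = m then x else 0) =
    (if n < m then scale (of_nat (n + m)) (M (int n - int m) x) else if n = m then scale (diag_coeff n) x else 0)"
proof -
  assume "m \<le> J"
  have "(\<Sum>j\<in>{n<..J}. scale (of_nat (n + j)) (M (int n - int j) (if j = m then x else 0))) =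
      (\<Sum>j\<in>{n<..J}. if j = m then scale (of_nat (n + m)) (M (int n - int m) x) else 0)"
    by (intro sum.cong) (auto simp: act_simps)
  then show ?thesis using \<open>m \<le> J\<close> by (simp add: row_def)
qed

lemma lin_row: "(\<And>j. lin (f j)) \<Longrightarrow> lin (\<lambda>x. row J n (\<lambda>j. f j x))"
  unfolding row_def by (intro lin_op_intros lin_compose[OF linear_M])

text \<open>
  The product rule for \<open>L (-m)\<close> has no lower terms when \<open>m\<close> is at least every index
  present, since no reordering of the \<open>L\<close>s is then needed.
\<close>

lemma deriv_L_L_max:
  assumes "0 \<notin># N" "\<forall>i\<in>#N. i \<le> m" "0 < m"
  shows "deriv_L j (L (- int m) (pbw {#} N)) = L (- int m) (deriv_L j (pbw {#} N)) + (if j = m then pbw {#} N else 0)"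
proof (cases "j \<in># N")
  case True
  then have "add_mset m (N - {#j#}) = add_mset m N - {#j#}" by simp
  moreover have "L (- int m) (pbw {#} (N - {#j#})) = pbw {#} (add_mset m (N - {#j#}))"
    using assms by (intro L_pbw_max) (meson in_diffD)
  ultimately show ?thesis using assms True
    by (auto simp: L_pbw_max deriv_L_pbw act_simps scale_left_distrib)
next
  case False
  then have "count N j = 0" by (simp add: not_in_iff)
  with assms show ?thesis by (auto simp: L_pbw_max deriv_L_pbw act_simps)
qed

text \<open>
  Modulo two fewer \<open>L\<close>s, \<open>M n\<close> is a first-order differential operator in the \<open>L\<close>s: one factor \<open>L (-j)\<close> is
  replaced by its bracket with \<open>M n\<close>. The induction splits off the largest factor.
\<close>

lemma M_leading_pbw_no_M:
  assumes "0 \<notin># N" "\<forall>j\<in>#N. j \<le> J"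
  shows "M (int n) (pbw {#} N) - (if n = 0 then scale hM (pbw {#} N) else 0)
    - row J n (\<lambda>j. deriv_L j (pbw {#} N)) \<in> L_filt (int (size N) - 1)"
  using assms
proof (induction "size N" arbitrary: N)
  case 0
  then show ?case by (simp add: M_zero M_pos L_filt_closed row_def deriv_L_pbw[of "{#}" "{#}", simplified] act_simps)
next
  case (Suc s)
  then have "N \<noteq> {#}" by auto
  then obtain m N' where N: "N = add_mset m N'" and m: "\<forall>i\<in>#N'. i \<le> m"
    by (rule max_decompose)
  have N': "0 \<notin># N'" "0 < m" "s = size N'" "m \<le> J" "\<forall>j\<in>#N'. j \<le> J" using Suc N by auto
  define w where "w = pbw {#} N'"
  define E where "E = (\<lambda>u. M (int n) u - (if n = 0 then scale hM u else 0) - row J n (\<lambda>j. deriv_L j u))"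
  have BN: "pbw {#} N = L (- int m) w" using L_pbw_max[OF m] N by (simp add: w_def)
  have w: "w \<in> L_filt (int (size N') + 1)" using N' by (auto simp: w_def intro!: pbw_in_L_filt)
  have IH: "L (- int m) (E w) \<in> L_filt (int (size N'))"
    using L_neg_L_filt[OF N'(2) Suc.hyps(1)[OF N'(3) N'(1,5)]] N'(3) by (simp add: E_def w_def)
  \<comment> \<open>\<open>R\<close> is the error of moving \<open>L (-m)\<close> to the left of the \<open>M\<close>s in the row.\<close>
  define R where "R = (\<Sum>j\<in>{n<..J}. scale (of_nat (n + j) * of_int (int m + (int n - int j)))
      (M (int n - int j - int m) (deriv_L j w)))"
  have R: "R \<in> L_filt (int (size N'))"
    using deriv_L_L_filt[OF w] unfolding R_def by (intro L_filt_closed M_neg_L_filt) auto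
  have "row J n (\<lambda>j. L (- int m) (deriv_L j w)) = L (- int m) (row J n (\<lambda>j. deriv_L j w)) + R"
  proof -
    have "scale (of_nat (n + j)) (M (int n - int j) (L (- int m) (deriv_L j w))) =
      L (- int m) (scale (of_nat (n + j)) (M (int n - int j) (deriv_L j w))) +
      scale (of_nat (n + j) * of_int (int m + (int n - int j))) (M (int n - int j - int m) (deriv_L j w))"
      if "n < j" for j
      unfolding M_L[of _ "- int m"] using that N'(2)
      by (simp add: act_simps algebra_simps)
    then show ?thesis
      unfolding row_def R_def by (simp add: act_simps sum.distrib)
  qed
  then have rowL: "row J n (\<lambda>j. deriv_L j (L (- int m) w)) = L (- int m) (row J n (\<lambda>j. deriv_L j w)) + R
      + (if n < m then scale (of_nat (n + m)) (M (int n - int m) w) else if n = m then scale (diag_coeff n) w else 0)"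
    unfolding w_def deriv_L_L_max[OF N'(1) m N'(2)] by (simp add: row_add row_single N')
  have actM: "M (int n) (L (- int m) w) = L (- int m) (M (int n) w)
      + scale (of_nat (n + m)) (M (int n - int m) w)
      + (if n = m then scale ((of_nat m ^ 3 - of_nat m) / 12 * cM) w else 0)"
    unfolding M_L_neg by (simp add: CM_eq add.commute)
  \<comment> \<open>\<open>X\<close> compares the bracket of \<open>M n\<close> with \<open>L (-m)\<close> to the term of the row in which \<open>L (-m)\<close> is
      differentiated. They differ where \<open>M (n - m)\<close> has index at least \<open>0\<close>; there \<open>M (n - m)\<close> acts on
      \<open>w\<close> by the scalar of the highest weight vector, modulo fewer \<open>L\<close>s.\<close>
  define X where "X = scale (of_nat (n + m)) (M (int n - int m) w)
      + (if n = m then scale ((of_nat m ^ 3 - of_nat m) / 12 * cM) w else 0)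
      - (if n < m then scale (of_nat (n + m)) (M (int n - int m) w) else if n = m then scale (diag_coeff n) w else 0)"
  have "X \<in> L_filt (int (size N'))"
  proof -
    consider "n < m" | "n = m" | "n > m" by linarith
    then show ?thesis
    proof cases
      case 2
      then have "X = scale (2 * of_nat n) (M 0 w - scale hM w)"
        by (simp add: X_def diag_coeff_def algebra_simps)
      moreover have "M 0 w - scale hM w \<in> L_filt (int (size N'))" using M_nonneg_L_filt[OF _ w, of 0] by simp
      ultimately show ?thesis by (simp add: L_filt_closed)
    next
      case 3
      then show ?thesis using M_nonneg_L_filt[OF _ w, of "int n - int m"] by (auto simp: X_def L_filt_closed)
    qed (simp add: X_def L_filt_closed)
  qed
  moreover have "E (pbw {#} N) = L (- int m) (E w) - R + X"
    unfolding BN E_def rowL actM X_def by (simp add: act_simps algebra_simps)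
  ultimately have "E (pbw {#} N) \<in> L_filt (int (size N'))"
    using IH R by (simp add: L_filt_closed)
  moreover have "int (size N) - 1 = int (size N')" by (simp add: N)
  ultimately show ?case unfolding E_def by (simp only:)
qed

lemma M_leading_pbw:
  assumes "0 \<notin># A" "0 \<notin># N" "\<forall>j\<in>#N. j \<le> J"
  shows "M (int n) (pbw A N) - (if n = 0 then scale hM (pbw A N) else 0)
    - row J n (\<lambda>j. deriv_L j (pbw A N)) \<in> L_filt (int (size N) - 1)"
  using assms(1)
proof (induction A)
  case empty
  show ?case using M_leading_pbw_no_M[OF assms(2,3)] .
next
  case (add a A)
  then have a: "0 < a" by auto
  have "M (int n) (M (- int a) u) - (if n = 0 then scale hM (M (- int a) u) else 0)
    - row J n (\<lambda>j. deriv_L j (M (- int a) u)) = M (- int a)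
    (M (int n) u - (if n = 0 then scale hM u else 0) - row J n (\<lambda>j. deriv_L j u))" for u
    unfolding deriv_L_M[OF a] row_M using M_commute[of "int n" "- int a"] by (simp add: act_simps)
  then show ?case using add a unfolding M_pbw[symmetric] by (auto intro: M_neg_L_filt)
qed

lemma M_leading:
  assumes "x \<in> pbw_span (\<lambda>A N. int (size N) < e + 1 \<and> (\<forall>j\<in>#N. j \<le> J))"
  shows "M (int n) x - (if n = 0 then scale hM x else 0) - row J n (\<lambda>j. deriv_L j x) \<in> L_filt (e - 1)"
  using assms
proof (rule pbw_span_lin_in[where f = "\<lambda>x. M (int n) x - (if n = 0 then scale hM x else 0) - row J n (\<lambda>j. deriv_L j x)", rotated -1])
  show "lin (\<lambda>x. M (int n) x - (if n = 0 then scale hM x else 0) - row J n (\<lambda>j. deriv_L j x))"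
    by (cases "n = 0") (auto intro!: lin_intros linear_M lin_row lin_deriv_L)
  fix A N :: "nat multiset" assume *: "0 \<notin># A" "0 \<notin># N" "int (size N) < e + 1 \<and> (\<forall>j\<in>#N. j \<le> J)"
  show "M (int n) (pbw A N) - (if n = 0 then scale hM (pbw A N) else 0)
    - row J n (\<lambda>j. deriv_L j (pbw A N)) \<in> L_filt (e - 1)"
    by (rule L_filt_mono[OF _ M_leading_pbw]) (use * in auto)
qed simp

lemma M_nonneg_no_L:
  assumes "0 \<le> j" "x \<in> L_filt 1"
  shows "M j x = (if j = 0 then scale hM x else 0)"
  using assms(2) unfolding L_filt_def
proof (rule pbw_span_lin_eq[where f = "M j", rotated -1])
  show "lin (\<lambda>x. if j = 0 then scale hM x else 0)"
    by (cases "j = 0") (auto intro!: lin_intros)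
  fix A N :: "nat multiset" assume *: "0 \<notin># A" "0 \<notin># N" "int (size N) < 1"
  then have "pbw A N = M_mono (dsort A) one" by (simp add: pbw_def)
  then show "M j (pbw A N) = (if j = 0 then scale hM (pbw A N) else 0)"
    using assms(1) by (simp add: M_M_mono M_zero M_pos lin_rules[OF lin_M_mono])
qed (rule linear_M)

text \<open>
  Here the formula has no error term: the bracket of \<open>L n\<close> with an \<open>M\<close> is again an \<open>M\<close>, which commutes
  with all other factors.
\<close>

lemma L_nonneg_pbw_no_L:
  assumes "0 \<notin># A" "\<forall>j\<in>#A. j \<le> J"
  shows "L (int n) (pbw A {#}) = (if n = 0 then scale hL (pbw A {#}) else 0) + row J n (\<lambda>j. deriv_M j (pbw A {#}))"
  using assms
proof (induction A)
  case empty
  show ?case by (simp add: L_zero L_pos row_def deriv_M_pbw[of "{#}" "{#}", simplified] act_simps)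
next
  case (add a A)
  then have a: "0 < a" "a \<le> J" by auto
  define u where "u = pbw A {#}"
  have IH: "L (int n) u = (if n = 0 then scale hL u else 0) + row J n (\<lambda>j. deriv_M j u)"
    using add by (simp add: u_def)
  have u: "u \<in> L_filt 1" using add by (auto simp: u_def intro: pbw_in_L_filt)
  have LM: "L (int n) (M (- int a) u) = M (- int a) (L (int n) u)
      + scale (of_nat (n + a)) (M (int n - int a) u)
      + (if n = a then scale ((of_nat a ^ 3 - of_nat a) / 12 * cM) u else 0)"
    unfolding L_M by (simp add: CM_eq algebra_simps)
  have rowM: "row J n (\<lambda>j. deriv_M j (M (- int a) u)) = M (- int a) (row J n (\<lambda>j. deriv_M j u))
      + (if n < a then scale (of_nat (n + a)) (M (int n - int a) u) else if n = a then scale (diag_coeff n) u else 0)"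
    unfolding deriv_M_M[OF a(1)] row_add by (simp add: row_M a row_single eq_commute[of a])
  have "M (int n - int a) u = (if n = a then scale hM u else 0)" if "\<not> n < a"
    using M_nonneg_no_L[OF _ u, of "int n - int a"] that by simp
  moreover have "scale (diag_coeff a) u = scale (of_nat (a + a)) (scale hM u)
      + scale ((of_nat a ^ 3 - of_nat a) / 12 * cM) u"
    by (simp add: diag_coeff_def scale_left_distrib[symmetric])
  ultimately show ?case unfolding M_pbw[symmetric] u_def[symmetric] LM rowM
    by (auto simp: IH act_simps)
qed

lemma L_nonneg_no_L:
  assumes "x \<in> pbw_span (\<lambda>A N. int (size N) < 1 \<and> (\<forall>j\<in>#A. j \<le> J))"
  shows "L (int n) x = (if n = 0 then scale hL x else 0) + row J n (\<lambda>j. deriv_M j x)"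
  using assms
proof (rule pbw_span_lin_eq[where f = "L (int n)", rotated -1])
  show "lin (\<lambda>x. (if n = 0 then scale hL x else 0) + row J n (\<lambda>j. deriv_M j x))"
    by (cases "n = 0") (auto intro!: lin_intros lin_row lin_deriv_M)
qed (auto simp: L_nonneg_pbw_no_L linear_L)

lemma one_nonzero: "one \<noteq> 0"
proof -
  define X where "X = {pbw A N | A N. 0 \<notin># A \<and> 0 \<notin># N}"
  have "independent X" using PBW_independent basis_eq by (simp add: X_def)
  then have "0 \<notin> X" using dependent_zero by blast
  moreover have "pbw {#} {#} \<in> X"
    unfolding X_def by (intro CollectI exI[of _ "{#}"]) simp
  ultimately show ?thesis by (metis pbw_empty)
qed

lemma deriv_M_M_neg: "n < 0 \<Longrightarrow> deriv_M j (M n x) = M n (deriv_M j x) + (if n = - int j then x else 0)"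
  using deriv_M_M[of "nat (- n)" j x] by auto

text \<open>
  In row \<open>0\<close> the diagonal entry vanishes, so agreement at positive indices suffices.
\<close>

lemma row_cong: "(\<And>j. n \<le> j \<Longrightarrow> j \<le> J \<Longrightarrow> 1 \<le> j \<Longrightarrow> b j = c j) \<Longrightarrow> n \<le> J \<Longrightarrow> row J n b = row J n c"
proof -
  assume *: "\<And>j. n \<le> j \<Longrightarrow> j \<le> J \<Longrightarrow> 1 \<le> j \<Longrightarrow> b j = c j" "n \<le> J"
  have "(\<Sum>j\<in>{n<..J}. scale (of_nat (n + j)) (M (int n - int j) (b j))) =
      (\<Sum>j\<in>{n<..J}. scale (of_nat (n + j)) (M (int n - int j) (c j)))"
    by (rule sum.cong) (simp_all add: *)
  moreover have "scale (diag_coeff n) (b n) = scale (diag_coeff n) (c n)"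
    using * by (cases "n = 0") simp_all
  ultimately show ?thesis by (simp add: row_def)
qed

lemma one_in_L_filt [simp]: "one \<in> L_filt 1"
  using pbw_in_L_filt[of "{#}" "{#}" 1] by simp

end

section \<open>Solving the triangular system\<close>

locale W22_Verma_atypical = W22_Verma +
  fixes p :: nat
  assumes cM_nonzero: "cM \<noteq> 0" and p_pos: "1 \<le> p"
    and atypical: "2 * hM + (of_nat p ^ 2 - 1) / 12 * cM = 0"
begin

text \<open>
  This is where the relation between \<open>hM\<close> and \<open>cM\<close> enters: among the positive \<open>n\<close> the diagonal
  vanishes for \<open>n = p\<close> only.
\<close>

lemma diag_coeff_eq: "diag_coeff n = of_nat n * (of_nat n ^ 2 - of_nat p ^ 2) / 12 * cM"
proof -
  have h: "2 * hM = - ((of_nat p ^ 2 - 1) / 12 * cM)" using atypical by (simp add: eq_neg_iff_add_eq_0)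
  have "diag_coeff n = of_nat n * (2 * hM) + (of_nat n ^ 3 - of_nat n) / 12 * cM"
    by (simp add: diag_coeff_def)
  also have "\<dots> = of_nat n * (of_nat n ^ 2 - of_nat p ^ 2) / 12 * cM"
    unfolding h by (simp add: field_simps power2_eq_square power3_eq_cube)
  finally show ?thesis .
qed

lemma diag_coeff_p [simp]: "diag_coeff p = 0"
  by (simp add: diag_coeff_eq)

lemma diag_coeff_nonzero: "1 \<le> n \<Longrightarrow> n \<noteq> p \<Longrightarrow> diag_coeff n \<noteq> 0"
proof -
  assume n: "1 \<le> n" "n \<noteq> p"
  then have "n ^ 2 \<noteq> p ^ 2" by simp
  then have "(of_nat (n ^ 2) :: complex) \<noteq> of_nat (p ^ 2)" by (metis of_nat_eq_iff)
  then show ?thesis using n cM_nonzero by (simp add: diag_coeff_eq)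
qed

text \<open>
  Back substitution in the system \<open>row n b = 0\<close>, \<open>n \<ge> 1\<close>: the row \<open>n = p\<close> leaves \<open>b p = v\<close> free, the
  rows above it determine \<open>b k\<close> for \<open>k < p\<close>, and \<open>b k = 0\<close> for \<open>k > p\<close>. For \<open>v = one\<close> these are the partial
  derivatives of \<open>S\<close>. At \<open>k = 0\<close> the formula divides by \<open>diag_coeff 0 = 0\<close>, so the value is \<open>0\<close>; it enters row
  \<open>0\<close> with the coefficient \<open>diag_coeff 0\<close>.
\<close>

function grad_S :: "nat \<Rightarrow> 'a \<Rightarrow> 'a" where
  "grad_S k v = (if p < k then 0 else if k = p then v else
     scale (- 1 / diag_coeff k) (\<Sum>j\<in>{k<..p}. scale (of_nat (k + j)) (M (int k - int j) (grad_S j v))))"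
  by pat_completeness auto
termination by (relation "measure (\<lambda>(k, v). p - k)") auto

declare grad_S.simps [simp del]

lemma grad_S_p [simp]: "grad_S p v = v" and grad_S_above [simp]: "p < k \<Longrightarrow> grad_S k v = 0"
  by (simp_all add: grad_S.simps)

text \<open>
  The row \<open>n = 0\<close> of the system on its solutions. By Euler's relation
  \<open>p S = (\<Sum>j. j M (-j) (\<partial>S/\<partial>M (-j)))\<close> this is \<open>p\<close> times \<open>S\<close>, which is confirmed in \<open>S_eq\<close>.
\<close>

definition pS :: "'a \<Rightarrow> 'a" where
  "pS v = row p 0 (\<lambda>j. grad_S j v)"

lemma row_grad_S_bound: "p \<le> J \<Longrightarrow> row J n (\<lambda>j. grad_S j v) = row p n (\<lambda>j. grad_S j v)"
  unfolding row_def
  by (intro arg_cong2[where f = "(+)"] sum.mono_neutral_right) (auto simp: act_simps)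

lemma row_grad_S:
  assumes "1 \<le> n" "p \<le> J" shows "row J n (\<lambda>j. grad_S j v) = 0"
proof -
  consider "p < n" | "n = p" | "n < p" by linarith
  then have "row p n (\<lambda>j. grad_S j v) = 0"
  proof cases
    case 3
    then have "scale (diag_coeff n) (grad_S n v) =
        - (\<Sum>j\<in>{n<..p}. scale (of_nat (n + j)) (M (int n - int j) (grad_S j v)))"
      using diag_coeff_nonzero[of n] assms by (subst grad_S.simps) simp
    then show ?thesis by (simp add: row_def)
  qed (simp_all add: row_def)
  with row_grad_S_bound[OF assms(2)] show ?thesis by simp
qed

lemma lin_grad_S: "lin (grad_S k)"
proof (induction "p - k" arbitrary: k rule: less_induct)
  case less
  consider "p < k" | "k = p" | "k < p" by linarith
  then show ?case
  proof cases
    case 3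
    have "lin (\<lambda>v. scale (- 1 / diag_coeff k)
        (\<Sum>j\<in>{k<..p}. scale (of_nat (k + j)) (M (int k - int j) (grad_S j v))))"
      using 3 by (intro lin_intros lin_compose[OF linear_M] less) auto
    then show ?thesis by (subst ext[OF grad_S.simps]) (use 3 in simp)
  qed (simp_all add: lin_iff)
qed

lemma lin_pS: "lin pS"
  unfolding pS_def[abs_def] by (intro lin_row lin_grad_S)

text \<open>
  The subspaces modulo which the triangular system is solved: the filtration steps in the part on
  \<open>L\<close>s, and the zero subspace in the part on \<open>M\<close>s.
\<close>

definition stable :: "'a set \<Rightarrow> bool" where
  "stable Z \<longleftrightarrow> subspace Z \<and> (\<forall>n x. n < 0 \<longrightarrow> x \<in> Z \<longrightarrow> M n x \<in> Z) \<and> (\<forall>x\<in>Z. deriv_M p x \<in> Z)"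

lemma stable_L_filt: "stable (L_filt e)"
  by (simp add: stable_def M_neg_L_filt deriv_M_L_filt)

lemma stable_zero: "stable {0}"
  by (simp add: stable_def act_simps deriv_simps)

lemma stable_grad_S: "stable Z \<Longrightarrow> v \<in> Z \<Longrightarrow> grad_S k v \<in> Z"
proof (induction k v rule: grad_S.induct)
  case (1 k v)
  then show ?case
    by (subst grad_S.simps)
      (auto simp: stable_def subspace_0 intro!: subspace_scale subspace_neg subspace_sum)
qed

lemma stable_row: "stable Z \<Longrightarrow> (\<And>j. n \<le> j \<Longrightarrow> j \<le> J \<Longrightarrow> 1 \<le> j \<Longrightarrow> b j \<in> Z) \<Longrightarrow> n \<le> J \<Longrightarrow> row J n b \<in> Z"
proof -
  assume Z: "stable Z" and b: "\<And>j. n \<le> j \<Longrightarrow> j \<le> J \<Longrightarrow> 1 \<le> j \<Longrightarrow> b j \<in> Z" and "n \<le> J"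
  have "scale (of_nat (n + j)) (M (int n - int j) (b j)) \<in> Z" if "j \<in> {n<..J}" for j
    using Z b[of j] that by (auto simp: stable_def intro!: subspace_scale)
  moreover have "scale (diag_coeff n) (b n) \<in> Z"
    using Z b[of n] \<open>n \<le> J\<close> by (cases "n = 0") (auto simp: stable_def subspace_0 subspace_scale)
  ultimately show ?thesis
    using Z unfolding row_def stable_def by (intro subspace_add subspace_sum) auto
qed

lemma stable_pS: "stable Z \<Longrightarrow> v \<in> Z \<Longrightarrow> pS v \<in> Z"
  unfolding pS_def by (rule stable_row) (simp_all add: stable_grad_S)

text \<open>
  Back substitution modulo a stable subspace, dividing by \<open>diag_coeff n \<noteq> 0\<close> for \<open>n \<noteq> p\<close>.
\<close>

lemma row_kernel:
  assumes Z: "stable Z" and J: "p \<le> J" and rows: "\<And>n. 1 \<le> n \<Longrightarrow> n \<le> J \<Longrightarrow> row J n b \<in> Z"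
  shows "1 \<le> n \<Longrightarrow> n \<le> J \<Longrightarrow> b n - grad_S n (b p) \<in> Z"
    and "row J 0 b - pS (b p) \<in> Z"
proof -
  define c where "c = (\<lambda>j. b j - grad_S j (b p))"
  have rowc: "row J n c = row J n b - row J n (\<lambda>j. grad_S j (b p))" for n
    by (simp add: c_def row_diff)
  have c: "c n \<in> Z" if "1 \<le> n" "n \<le> J" for n
    using that
  proof (induction "J - n" arbitrary: n rule: less_induct)
    case less
    show ?case
    proof (cases "n = p")
      case True
      then show ?thesis using Z by (simp add: c_def stable_def subspace_0)
    next
      case False
      have "row J n c \<in> Z"
        using rowc row_grad_S[OF less.prems(1) J] rows[OF less.prems] by simp
      moreover have "(\<Sum>j\<in>{n<..J}. scale (of_nat (n + j)) (M (int n - int j) (c j))) \<in> Z"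
        using less Z by (auto simp: stable_def intro!: subspace_sum subspace_scale)
      moreover have "scale (diag_coeff n) (c n) = row J n c -
          (\<Sum>j\<in>{n<..J}. scale (of_nat (n + j)) (M (int n - int j) (c j)))"
        by (simp add: row_def)
      ultimately have "scale (diag_coeff n) (c n) \<in> Z"
        using Z by (simp add: stable_def subspace_diff)
      then have "scale (inverse (diag_coeff n)) (scale (diag_coeff n) (c n)) \<in> Z"
        using Z subspace_scale by (blast dest: stable_def[THEN iffD1])
      then show ?thesis using diag_coeff_nonzero[OF less.prems(1) False] by simp
    qed
  qed
  then show "b n - grad_S n (b p) \<in> Z" if "1 \<le> n" "n \<le> J"
    using that by (simp add: c_def)
  have "row J 0 c \<in> Z" using Z c by (intro stable_row) auto
  then show "row J 0 b - pS (b p) \<in> Z"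
    by (simp add: rowc row_grad_S_bound[OF J] pS_def)
qed

text \<open>
  Only the \<open>M (-i)\<close> with \<open>i < p\<close> occur in \<open>grad_S k\<close> for \<open>k \<ge> 1\<close>.
\<close>

lemma deriv_M_grad_S: "1 \<le> k \<Longrightarrow> deriv_M p (grad_S k v) = grad_S k (deriv_M p v)"
proof (induction k v rule: grad_S.induct)
  case (1 k v)
  consider "p < k" | "k = p" | "k < p" by linarith
  then show ?case
  proof cases
    case 3
    have "deriv_M p (M (int k - int j) (grad_S j v)) = M (int k - int j) (grad_S j (deriv_M p v))"
      if "j \<in> {k<..p}" for j
      using that 3 1 by (subst deriv_M_M_neg) auto
    then show ?thesis
      by (subst (1 2) grad_S.simps) (simp add: deriv_simps)
  qed (simp_all add: deriv_simps)
qed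

text \<open>
  The only \<open>M (-p)\<close> in \<open>pS\<close> is in the summand \<open>p M (-p)\<close>.
\<close>

lemma deriv_M_pS: "deriv_M p (pS v) = pS (deriv_M p v) + scale (of_nat p) v"
proof -
  have "deriv_M p (M (- int j) (grad_S j v)) = M (- int j) (grad_S j (deriv_M p v)) + (if j = p then v else 0)"
    if "j \<in> {0<..p}" for j
    using that by (subst deriv_M_M_neg) (auto simp: deriv_M_grad_S)
  then have "deriv_M p (pS v) = (\<Sum>j\<in>{0<..p}. scale (of_nat j) (M (- int j) (grad_S j (deriv_M p v))
      + (if j = p then v else 0)))"
    by (simp add: pS_def row_def deriv_simps)
  also have "\<dots> = (\<Sum>j\<in>{0<..p}. scale (of_nat j) (M (- int j) (grad_S j (deriv_M p v))))
      + (\<Sum>j\<in>{0<..p}. if j = p then scale (of_nat p) v else 0)"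
    by (simp add: scale_right_distrib sum.distrib if_distrib[of "scale _"] cong: if_cong)
  also have "\<dots> = pS (deriv_M p v) + scale (of_nat p) v"
    using p_pos by (simp add: pS_def row_def)
  finally show ?thesis .
qed

lemma deriv_M_power_pS:
  "(deriv_M p ^^ Suc i) (pS v) = pS ((deriv_M p ^^ Suc i) v) + scale (of_nat (Suc i * p)) ((deriv_M p ^^ i) v)"
proof (induction i)
  case (Suc i)
  have "(deriv_M p ^^ Suc (Suc i)) (pS v) = deriv_M p ((deriv_M p ^^ Suc i) (pS v))" by simp
  also have "\<dots> = pS ((deriv_M p ^^ Suc (Suc i)) v) + (scale (of_nat p) ((deriv_M p ^^ Suc i) v)
      + scale (of_nat (Suc i * p)) ((deriv_M p ^^ Suc i) v))"
    unfolding Suc by (simp add: deriv_simps deriv_M_pS)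
  also have "scale (of_nat p) ((deriv_M p ^^ Suc i) v) + scale (of_nat (Suc i * p)) ((deriv_M p ^^ Suc i) v) =
      scale (of_nat (Suc (Suc i) * p)) ((deriv_M p ^^ Suc i) v)"
    by (simp only: scale_left_distrib[symmetric] of_nat_add[symmetric] mult_Suc)
  finally show ?case .
qed (simp add: deriv_M_pS)

lemma deriv_M_power_pbw: "0 \<notin># A \<Longrightarrow> 0 \<notin># N \<Longrightarrow> count A p < e \<Longrightarrow> (deriv_M p ^^ e) (pbw A N) = 0"
proof (induction e arbitrary: A)
  case (Suc e)
  show ?case
  proof (cases "p \<in># A")
    case True
    then have "0 < count A p" by simp
    then have "count (A - {#p#}) p < e" using Suc.prems(3) by (simp del: count_greater_zero_iff)
    with True show ?thesis
      using Suc.IH[of "A - {#p#}"] Suc.prems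
      by (simp add: funpow_Suc_right pos_diff deriv_M_pbw lin_rules[OF lin_funpow[OF lin_deriv_M]] del: funpow.simps)
  next
    case False
    then show ?thesis
      using Suc.prems
      by (simp add: funpow_Suc_right deriv_M_pbw not_in_iff lin_rules[OF lin_funpow[OF lin_deriv_M]] del: funpow.simps)
  qed
qed simp

lemma deriv_M_locally_nilpotent: "\<exists>e. (deriv_M p ^^ e) v = 0"
proof -
  have "v \<in> pbw_span (\<lambda>A N. True)" by (simp add: pbw_span_UNIV)
  then obtain J where "v \<in> pbw_span (\<lambda>A N. True \<and> count A p \<le> J)" by (rule pbw_span_bounded)
  then have "(deriv_M p ^^ Suc J) v = 0"
    by (rule pbw_span_lin_eq[OF lin_funpow[OF lin_deriv_M] lin_zero, rotated -1]) (intro deriv_M_power_pbw, auto)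
  then show ?thesis by blast
qed

text \<open>
  Multiplication by \<open>pS\<close> is injective modulo stable subspaces. If \<open>i' + 1\<close> is the least number of
  derivatives that takes \<open>b\<close> into \<open>Z\<close>, then by the Weyl relation as many derivatives of \<open>pS b\<close> agree modulo
  \<open>Z\<close> with a nonzero multiple of the \<open>i'\<close>-th derivative of \<open>b\<close>, which is not in \<open>Z\<close>.
\<close>

lemma pS_reflects_stable:
  assumes Z: "stable Z" and "pS b \<in> Z"
  shows "b \<in> Z"
proof -
  have Z0: "subspace Z" using Z by (simp add: stable_def)
  have dZ: "(deriv_M p ^^ i) x \<in> Z" if "x \<in> Z" for i x
    using that Z by (induction i) (auto simp: stable_def)
  obtain e where e: "(deriv_M p ^^ e) b = 0" using deriv_M_locally_nilpotent by blast
  \<comment> \<open>The least order of a derivative in \<open>Z\<close> exists because \<open>deriv_M p\<close> is locally nilpotent.\<close>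
  define i where "i = (LEAST i. (deriv_M p ^^ i) b \<in> Z)"
  have iZ: "(deriv_M p ^^ i) b \<in> Z"
    unfolding i_def by (rule LeastI[of _ e]) (simp add: e subspace_0[OF Z0])
  show ?thesis
  proof (cases i)
    case 0
    with iZ show ?thesis by simp
  next
    case (Suc i')
    then have notin: "(deriv_M p ^^ i') b \<notin> Z"
      using not_less_Least[of i' "\<lambda>i. (deriv_M p ^^ i) b \<in> Z"] by (simp add: i_def)
    have "scale (of_nat (Suc i' * p)) ((deriv_M p ^^ i') b) = (deriv_M p ^^ Suc i') (pS b) - pS ((deriv_M p ^^ Suc i') b)"
      unfolding deriv_M_power_pS by simp
    also have "\<dots> \<in> Z"
      using dZ[OF assms(2), of "Suc i'"] stable_pS[OF Z iZ] unfolding Suc by (rule subspace_diff[OF Z0])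
    finally have "scale (inverse (of_nat (Suc i' * p))) (scale (of_nat (Suc i' * p)) ((deriv_M p ^^ i') b)) \<in> Z"
      by (rule subspace_scale[OF Z0])
    moreover have "(of_nat (Suc i' * p) :: complex) \<noteq> 0" using p_pos by (simp only: of_nat_eq_0_iff) simp
    ultimately have "(deriv_M p ^^ i') b \<in> Z" by (simp del: of_nat_mult of_nat_Suc mult_Suc)
    with notin show ?thesis by blast
  qed
qed

section \<open>Existence and uniqueness of \<open>S\<close>\<close>

text \<open>
  The cocycle identity behind the central term, a case of the Jacobi identity.
\<close>

lemma diag_coeff_cocycle:
  "(2 * of_nat n + of_nat m) * diag_coeff m + (of_nat n - of_nat m) * diag_coeff (n + m)
    = (2 * of_nat m + of_nat n) * diag_coeff n"
  by (simp add: diag_coeff_def field_simps power3_eq_cube power2_eq_square)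

text \<open>
  The relation \<open>L m (grad_S j one) = - (2 m + j) grad_S (j + m) one\<close> says that the \<open>grad_S j one\<close> transform
  under the \<open>L m\<close> like the derivatives of an invariant polynomial. If it holds for all \<open>j > n\<close>, then applying
  \<open>L m\<close> to the off-diagonal part of row \<open>n\<close> gives terms that combine, after the shift \<open>j \<mapsto> j + m\<close>, to the
  off-diagonal part of row \<open>n + m\<close>, which is known; the scalars add up by the cocycle identity.
\<close>

lemma L_row_grad_S_one:
  assumes m: "1 \<le> m"
    and IH: "\<And>j. n < j \<Longrightarrow> L (int m) (grad_S j one) = scale (- (2 * of_nat m + of_nat j)) (grad_S (j + m) one)"
  shows "L (int m) (\<Sum>j\<in>{n<..p}. scale (of_nat (n + j)) (M (int n - int j) (grad_S j one)))
    = scale ((2 * of_nat m + of_nat n) * diag_coeff n) (grad_S (n + m) one)"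
proof -
  define g where "g = (\<lambda>j. grad_S j one)"
  have gW: "g j \<in> L_filt 1" for j unfolding g_def by (intro stable_grad_S stable_L_filt one_in_L_filt)
  define F where "F = (\<lambda>j. scale (- ((of_nat n + of_nat j - of_nat m) * (of_nat m + of_nat j)))
      (M (int n + int m - int j) (g j)))"
  define G where "G = (\<lambda>j. scale ((of_nat n + of_nat j) * (of_nat m + of_nat j - of_nat n))
      (M (int n + int m - int j) (g j)))"
  define X where "X = scale ((2 * of_nat n + of_nat m) * diag_coeff m) (g (n + m))"
  \<comment> \<open>\<open>F\<close> collects \<open>L m\<close> acting on \<open>grad_S j one\<close>, shifted by \<open>m\<close>; \<open>G\<close> and \<open>X\<close> come from the bracket
      of \<open>L m\<close> with \<open>M (n - j)\<close>, whose index is negative for \<open>j > n + m\<close> and zero for \<open>j = n + m\<close>.\<close>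
  have step: "L (int m) (scale (of_nat (n + j)) (M (int n - int j) (g j))) =
      F (j + m) + ((if j = n + m then X else 0) + (if n + m < j then G j else 0))"
    if "j \<in> {n<..p}" for j
  proof -
    have "L (int m) (M (int n - int j) (g j)) = M (int n - int j) (L (int m) (g j))
        + (scale (of_nat m + of_nat j - of_nat n) (M (int n + int m - int j) (g j))
        + (if j = n + m then scale ((of_nat m ^ 3 - of_nat m) / 12 * cM) (g j) else 0))"
      unfolding L_M by (auto simp: CM_eq algebra_simps)
    also have "M (int n - int j) (L (int m) (g j)) =
        scale (- (2 * of_nat m + of_nat j)) (M (int n + int m - int (j + m)) (g (j + m)))"
      using IH[of j] that by (simp add: g_def act_simps)
    also have "scale (of_nat m + of_nat j - of_nat n) (M (int n + int m - int j) (g j))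
        + (if j = n + m then scale ((of_nat m ^ 3 - of_nat m) / 12 * cM) (g j) else 0) =
        (if j = n + m then scale (diag_coeff m) (g (n + m)) else 0)
        + (if n + m < j then scale (of_nat m + of_nat j - of_nat n) (M (int n + int m - int j) (g j)) else 0)"
    proof -
      consider "j < n + m" | "j = n + m" | "n + m < j" by linarith
      then show ?thesis
      proof cases
        case 1
        then show ?thesis using M_nonneg_no_L[OF _ gW, of "int n + int m - int j"] by simp
      next
        case 2
        then show ?thesis using M_nonneg_no_L[OF _ gW, of 0]
          by (simp add: diag_coeff_def scale_left_distrib[symmetric] mult.assoc)
      qed simp
    qed
    finally have "L (int m) (scale (of_nat (n + j)) (M (int n - int j) (g j))) =
        scale (of_nat (n + j)) (scale (- (2 * of_nat m + of_nat j)) (M (int n + int m - int (j + m)) (g (j + m)))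
        + ((if j = n + m then scale (diag_coeff m) (g (n + m)) else 0)
        + (if n + m < j then scale (of_nat m + of_nat j - of_nat n) (M (int n + int m - int j) (g j)) else 0)))"
      by (simp only: act_simps(2))
    also have "\<dots> = F (j + m) + ((if j = n + m then X else 0) + (if n + m < j then G j else 0))"
    proof -
      have "F (j + m) = scale (of_nat (n + j))
          (scale (- (2 * of_nat m + of_nat j)) (M (int n + int m - int (j + m)) (g (j + m))))"
        unfolding F_def scale_scale by (rule arg_cong2[where f = scale]) (simp_all add: algebra_simps)
      moreover have "scale (of_nat (n + j)) (if j = n + m then scale (diag_coeff m) (g (n + m)) else 0) =
          (if j = n + m then X else 0)"
      proof -
        have "of_nat (n + (n + m)) = (2 * of_nat n + of_nat m :: complex)" by simp
        then show ?thesis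
          by (cases "j = n + m") (simp_all only: X_def scale_scale scale_zero_right simp_thms if_True if_False)
      qed
      moreover have "scale (of_nat (n + j)) (if n + m < j then
            scale (of_nat m + of_nat j - of_nat n) (M (int n + int m - int j) (g j)) else 0) =
          (if n + m < j then G j else 0)"
        by (simp add: G_def)
      ultimately show ?thesis by (simp only: scale_right_distrib)
    qed
    finally show ?thesis .
  qed
  have "L (int m) (\<Sum>j\<in>{n<..p}. scale (of_nat (n + j)) (M (int n - int j) (g j))) =
      (\<Sum>j\<in>{n<..p}. F (j + m)) + ((\<Sum>j\<in>{n<..p}. if j = n + m then X else 0)
      + (\<Sum>j\<in>{n<..p}. if n + m < j then G j else 0))"
    unfolding act_simps(6) sum.distrib[symmetric] by (intro sum.cong refl step)
  also have "(\<Sum>j\<in>{n<..p}. F (j + m)) = (\<Sum>j\<in>{n+m<..p}. F j)"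
  proof -
    have "(\<Sum>j\<in>{n<..p}. F (j + m)) = (\<Sum>j\<in>{n+m<..p+m}. F j)"
      using sum.shift_bounds_cl_nat_ivl[of F "Suc n" m p]
      by (simp add: atLeastSucAtMost_greaterThanAtMost)
    also have "\<dots> = (\<Sum>j\<in>{n+m<..p}. F j)"
      by (rule sum.mono_neutral_right) (auto simp: F_def g_def act_simps)
    finally show ?thesis .
  qed
  also have "(\<Sum>j\<in>{n<..p}. if j = n + m then X else 0) = X"
    using m by (auto simp: X_def g_def)
  also have "(\<Sum>j\<in>{n<..p}. if n + m < j then G j else 0) = (\<Sum>j\<in>{n+m<..p}. G j)"
    by (rule sum.mono_neutral_cong_right) auto
  also have "(\<Sum>j\<in>{n+m<..p}. F j) + (X + (\<Sum>j\<in>{n+m<..p}. G j)) =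
      X - scale (of_nat n - of_nat m)
        (\<Sum>j\<in>{n+m<..p}. scale (of_nat (n + m + j)) (M (int (n + m) - int j) (g j)))"
  proof -
    have "F j + G j = - scale (of_nat n - of_nat m)
        (scale (of_nat (n + m + j)) (M (int (n + m) - int j) (g j)))" for j
    proof -
      have "F j + G j = scale (- ((of_nat n + of_nat j - of_nat m) * (of_nat m + of_nat j))
          + (of_nat n + of_nat j) * (of_nat m + of_nat j - of_nat n)) (M (int n + int m - int j) (g j))"
        by (simp only: F_def G_def scale_left_distrib)
      also have "- ((of_nat n + of_nat j - of_nat m) * (of_nat m + of_nat j))
          + (of_nat n + of_nat j) * (of_nat m + of_nat j - of_nat n) =
          - ((of_nat n - of_nat m) * of_nat (n + m + j) :: complex)"
        by (simp add: algebra_simps)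
      finally show ?thesis by simp
    qed
    then have "(\<Sum>j\<in>{n+m<..p}. F j) + (\<Sum>j\<in>{n+m<..p}. G j) = - scale (of_nat n - of_nat m)
        (\<Sum>j\<in>{n+m<..p}. scale (of_nat (n + m + j)) (M (int (n + m) - int j) (g j)))"
      by (simp add: sum.distrib[symmetric] sum_negf scale_sum_right)
    then show ?thesis by (simp add: algebra_simps)
  qed
  also have "(\<Sum>j\<in>{n+m<..p}. scale (of_nat (n + m + j)) (M (int (n + m) - int j) (g j))) =
      - scale (diag_coeff (n + m)) (g (n + m))"
    using row_grad_S[of "n + m" p one] m unfolding row_def g_def by (simp add: eq_neg_iff_add_eq_0)
  also have "X - scale (of_nat n - of_nat m) (- scale (diag_coeff (n + m)) (g (n + m))) =
      scale ((2 * of_nat n + of_nat m) * diag_coeff m + (of_nat n - of_nat m) * diag_coeff (n + m)) (g (n + m))"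
    by (simp add: X_def scale_left_distrib)
  finally show ?thesis by (simp add: diag_coeff_cocycle g_def)
qed

text \<open>
  Downward induction: row \<open>k\<close> expresses \<open>grad_S k\<close> by its off-diagonal part divided by \<open>diag_coeff k\<close>.
\<close>

lemma L_grad_S_one:
  assumes m: "1 \<le> m"
  shows "1 \<le> k \<Longrightarrow> L (int m) (grad_S k one) = scale (- (2 * of_nat m + of_nat k)) (grad_S (k + m) one)"
proof (induction "p - k" arbitrary: k rule: less_induct)
  case less
  have IH: "L (int m) (grad_S j one) = scale (- (2 * of_nat m + of_nat j)) (grad_S (j + m) one)" if "k < j" for j
  proof (cases "p < j")
    case True
    then show ?thesis by (simp add: act_simps)
  next
    case False
    with that less show ?thesis by simp
  qed
  consider "p < k" | "k = p" | "k < p" by linarith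
  then show ?case
  proof cases
    case 1
    then show ?thesis by (simp add: act_simps)
  next
    case 2
    then show ?thesis using m by (simp add: L_pos)
  next
    case 3
    have gk: "grad_S k one = scale (- 1 / diag_coeff k)
        (\<Sum>j\<in>{k<..p}. scale (of_nat (k + j)) (M (int k - int j) (grad_S j one)))"
      using 3 by (subst grad_S.simps) simp
    have "L (int m) (grad_S k one) = scale (- 1 / diag_coeff k)
        (scale ((2 * of_nat m + of_nat k) * diag_coeff k) (grad_S (k + m) one))"
      unfolding gk by (simp only: act_simps(2) L_row_grad_S_one[OF m IH])
    also have "\<dots> = scale (- 1 / diag_coeff k * ((2 * of_nat m + of_nat k) * diag_coeff k)) (grad_S (k + m) one)"
      by (rule scale_scale)
    also have "- 1 / diag_coeff k * ((2 * of_nat m + of_nat k) * diag_coeff k) = - (2 * of_nat m + of_nat k)"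
      using diag_coeff_nonzero[of k] less.prems 3 by simp
    finally show ?thesis .
  qed
qed

text \<open>
  The case \<open>n = 0\<close> of \<open>L_row_grad_S_one\<close>: the result carries the factor \<open>diag_coeff 0 = 0\<close>.
\<close>

lemma L_pS_one: "1 \<le> m \<Longrightarrow> L (int m) (pS one) = 0"
proof -
  assume m: "1 \<le> m"
  have "L (int m) (\<Sum>j\<in>{0<..p}. scale (of_nat (0 + j)) (M (int 0 - int j) (grad_S j one)))
    = scale ((2 * of_nat m + of_nat 0) * diag_coeff 0) (grad_S (0 + m) one)"
    by (rule L_row_grad_S_one[OF m]) (use L_grad_S_one[OF m] in simp)
  then show ?thesis by (simp add: pS_def row_def)
qed

text \<open>
  The operators given by polynomials of weight \<open>q\<close> in the \<open>M (-i)\<close>, with coefficients normalised to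
  vanish off the partitions of \<open>q\<close>, as the characterisation of \<open>S_coeff\<close> demands.
\<close>

definition M_homogeneous :: "nat \<Rightarrow> ('a \<Rightarrow> 'a) \<Rightarrow> bool" where
  "M_homogeneous q f \<longleftrightarrow> (\<exists>s. (\<forall>\<mu>. \<mu> \<notin> partitions_of q \<longrightarrow> s \<mu> = 0) \<and> (\<forall>v. f v = M_poly q s v))"

lemma M_homogeneousE:
  assumes "M_homogeneous q f"
  obtains s where "\<And>\<mu>. \<mu> \<notin> partitions_of q \<Longrightarrow> s \<mu> = 0" "f = M_poly q s"
  using assms unfolding M_homogeneous_def by (metis ext)

lemma M_homogeneous_zero: "M_homogeneous q (\<lambda>v. 0)"
  unfolding M_homogeneous_def by (intro exI[of _ "\<lambda>_. 0"]) (simp add: M_poly_def)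

lemma M_homogeneous_add: "M_homogeneous q f \<Longrightarrow> M_homogeneous q g \<Longrightarrow> M_homogeneous q (\<lambda>v. f v + g v)"
proof -
  assume "M_homogeneous q f" "M_homogeneous q g"
  then obtain s t where "\<And>\<mu>. \<mu> \<notin> partitions_of q \<Longrightarrow> s \<mu> = 0" "f = M_poly q s"
    "\<And>\<mu>. \<mu> \<notin> partitions_of q \<Longrightarrow> t \<mu> = 0" "g = M_poly q t"
    by (metis M_homogeneousE)
  then show ?thesis unfolding M_homogeneous_def
    by (intro exI[of _ "\<lambda>\<mu>. s \<mu> + t \<mu>"]) (simp add: M_poly_def scale_left_distrib sum.distrib)
qed

lemma M_homogeneous_scale: "M_homogeneous q f \<Longrightarrow> M_homogeneous q (\<lambda>v. scale c (f v))"
proof -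
  assume "M_homogeneous q f"
  then obtain s where "\<And>\<mu>. \<mu> \<notin> partitions_of q \<Longrightarrow> s \<mu> = 0" "f = M_poly q s"
    by (metis M_homogeneousE)
  then show ?thesis unfolding M_homogeneous_def
    by (intro exI[of _ "\<lambda>\<mu>. c * s \<mu>"]) (simp add: M_poly_def scale_sum_right)
qed

lemma M_homogeneous_sum: "(\<And>i. i \<in> I \<Longrightarrow> M_homogeneous q (f i)) \<Longrightarrow> M_homogeneous q (\<lambda>v. \<Sum>i\<in>I. f i v)"
  by (induction I rule: infinite_finite_induct) (auto intro: M_homogeneous_add M_homogeneous_zero)

lemma M_homogeneous_mono:
  assumes "0 \<notin> set \<mu>" "sum_list \<mu> = q" shows "M_homogeneous q (M_mono \<mu>)"
proof -
  let ?\<mu> = "dsort (mset \<mu>)"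
  have "sum_list ?\<mu> = q" using assms(2) by (metis mset_dsort sum_mset_sum_list)
  then have mem: "?\<mu> \<in> partitions_of q"
    using assms by (simp add: partitions_of_def is_partition_dsort)
  have "M_mono \<mu> v = M_poly q (\<lambda>\<nu>. if \<nu> = ?\<mu> then 1 else 0) v" for v
  proof -
    have "M_poly q (\<lambda>\<nu>. if \<nu> = ?\<mu> then 1 else 0) v =
        (\<Sum>\<nu>\<in>partitions_of q. if \<nu> = ?\<mu> then M_mono ?\<mu> v else 0)"
      unfolding M_poly_def by (intro sum.cong) auto
    also have "\<dots> = M_mono ?\<mu> v" using mem finite_partitions_of by simp
    also have "\<dots> = M_mono \<mu> v" by (rule M_mono_perm) simp
    finally show ?thesis by simp
  qed
  with mem show ?thesis
    unfolding M_homogeneous_def by (intro exI[of _ "\<lambda>\<nu>. if \<nu> = ?\<mu> then 1 else 0"]) auto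
qed

lemma M_homogeneous_M:
  assumes "0 < i" "M_homogeneous q f" shows "M_homogeneous (q + i) (\<lambda>v. M (- int i) (f v))"
proof -
  obtain s where s: "f = M_poly q s" using assms(2) by (rule M_homogeneousE)
  have "M_homogeneous (q + i) (\<lambda>v. \<Sum>\<mu>\<in>partitions_of q. scale (s \<mu>) (M_mono (i # \<mu>) v))"
    using assms(1) by (intro M_homogeneous_sum M_homogeneous_scale M_homogeneous_mono)
      (auto simp: partitions_of_def is_partition_def)
  then show ?thesis by (simp add: s M_poly_def act_simps)
qed

lemma M_homogeneous_grad_S: "1 \<le> k \<Longrightarrow> k \<le> p \<Longrightarrow> M_homogeneous (p - k) (grad_S k)"
proof (induction "p - k" arbitrary: k rule: less_induct)
  case less
  show ?case
  proof (cases "k = p")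
    case True
    have "M_homogeneous 0 (M_mono [])" by (rule M_homogeneous_mono) simp_all
    moreover have "M_mono [] = grad_S p" by (rule ext) simp
    ultimately show ?thesis using True by simp
  next
    case False
    have "M_homogeneous (p - k) (\<lambda>v. M (int k - int j) (grad_S j v))" if "j \<in> {k<..p}" for j
      using M_homogeneous_M[of "j - k" "p - j" "grad_S j"] less.hyps[of j] less.prems that
      by (simp add: of_nat_diff diff_less_mono2)
    then have "M_homogeneous (p - k) (\<lambda>v. scale (- 1 / diag_coeff k)
        (\<Sum>j\<in>{k<..p}. scale (of_nat (k + j)) (M (int k - int j) (grad_S j v))))"
      by (intro M_homogeneous_scale M_homogeneous_sum)
    then show ?thesis by (subst ext[OF grad_S.simps]) (use less.prems False in simp)
  qed
qed

lemma M_homogeneous_pS: "M_homogeneous p pS"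
proof -
  have "M_homogeneous p (\<lambda>v. M (- int j) (grad_S j v))" if "j \<in> {0<..p}" for j
    using M_homogeneous_M[OF _ M_homogeneous_grad_S, of j j] that by simp
  then have "M_homogeneous p (\<lambda>v. \<Sum>j\<in>{0<..p}. scale (of_nat j) (M (- int j) (grad_S j v)))"
    by (intro M_homogeneous_sum M_homogeneous_scale)
  then show ?thesis by (simp add: pS_def[abs_def] row_def)
qed

lemma M_mono_one: "M_mono \<mu> one = pbw (mset \<mu>) {#}"
proof -
  have "M_mono \<mu> one = M_mono (dsort (mset \<mu>)) one" by (rule M_mono_perm) simp
  then show ?thesis by (simp add: pbw_def)
qed

lemma L_zero_M_mono: "L 0 (M_mono \<mu> one) = scale (hL + of_nat (sum_list \<mu>)) (M_mono \<mu> one)"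
  by (induction \<mu>) (simp_all add: L_zero L_M act_simps algebra_simps)

lemma L_zero_M_poly: "L 0 (M_poly q s one) = scale (hL + of_nat q) (M_poly q s one)"
  unfolding M_poly_def act_simps scale_sum_right
  by (intro sum.cong) (simp_all add: L_zero_M_mono partitions_of_def mult.commute)

lemma M_poly_in_pbw_span:
  "M_poly q s one \<in> pbw_span (\<lambda>A N. int (size N) < 1 \<and> (\<forall>j\<in>#A. j \<le> q))"
  unfolding M_poly_def
proof (intro subspace_sum[OF subspace_pbw_span] subspace_scale[OF subspace_pbw_span])
  fix \<mu> assume "\<mu> \<in> partitions_of q"
  then have "0 \<notin> set \<mu>" "\<forall>j\<in>set \<mu>. j \<le> q"
    by (auto simp: partitions_of_def is_partition_def member_le_sum_list)
  then show "M_mono \<mu> one \<in> pbw_span (\<lambda>A N. int (size N) < 1 \<and> (\<forall>j\<in>#A. j \<le> q))"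
    unfolding M_mono_one by (intro pbw_in_span) auto
qed

lemma pbw_span_no_L: "x \<in> pbw_span (\<lambda>A N. int (size N) < 1 \<and> Q A N) \<Longrightarrow> x \<in> L_filt 1"
  unfolding L_filt_def using pbw_span_mono[of "\<lambda>A N. int (size N) < 1 \<and> Q A N" "\<lambda>A N. int (size N) < 1"] by blast

text \<open>
  The partition \<open>[p]\<close> is the only partition of \<open>p\<close> with a part \<open>p\<close>.
\<close>

lemma deriv_M_M_poly: "deriv_M p (M_poly p s one) = scale (s [p]) one"
proof -
  have "deriv_M p (M_mono \<mu> one) = (if \<mu> = [p] then one else 0)" if \<mu>: "\<mu> \<in> partitions_of p" for \<mu>
  proof (cases "p \<in> set \<mu>")
    case True
    then obtain xs ys where xy: "\<mu> = xs @ p # ys" by (auto simp: in_set_conv_decomp)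
    with \<mu> have "sum_list xs + sum_list ys = 0" "\<forall>i\<in>set xs \<union> set ys. 1 \<le> i"
      by (auto simp: partitions_of_def is_partition_def)
    then have "xs = []" "ys = []" by (cases xs; cases ys; auto)+
    with xy p_pos show ?thesis by (simp add: M_mono_one deriv_M_pbw)
  next
    case False
    moreover have "0 \<notin> set \<mu>" using \<mu> by (auto simp: partitions_of_def is_partition_def)
    moreover have "count (mset \<mu>) p = 0" using False by (simp add: not_in_iff[symmetric])
    ultimately show ?thesis by (auto simp: M_mono_one deriv_M_pbw)
  qed
  then have "deriv_M p (M_poly p s one) = (\<Sum>\<mu>\<in>partitions_of p. if \<mu> = [p] then scale (s [p]) one else 0)"
    unfolding M_poly_def deriv_simps by (intro sum.cong) auto
  also have "\<dots> = scale (s [p]) one"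
    using p_pos finite_partitions_of by (simp add: partitions_of_def is_partition_def)
  finally show ?thesis .
qed

lemma M_poly_inject:
  assumes "M_poly q s one = M_poly q t one" "\<mu> \<in> partitions_of q"
  shows "s \<mu> = t \<mu>"
proof -
  from lin_extend[of "\<lambda>A N. if A = mset \<mu> then one else 0"]
  obtain g where g0: "lin g" "\<forall>A N. 0 \<notin># A \<longrightarrow> 0 \<notin># N \<longrightarrow> g (pbw A N) = (if A = mset \<mu> then one else 0)"
    by (elim exE conjE)
  then have g: "lin g"
    "0 \<notin># A \<Longrightarrow> 0 \<notin># N \<Longrightarrow> g (pbw A N) = (if A = mset \<mu> then one else 0)" for A N
    by simp_all
  have "g (M_mono \<nu> one) = (if \<nu> = \<mu> then one else 0)" if "\<nu> \<in> partitions_of q" for \<nu>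
  proof -
    have "dsort (mset \<nu>) = \<nu>" "dsort (mset \<mu>) = \<mu>"
      using that assms(2) by (simp_all add: dsort_mset partitions_of_def is_partition_def)
    then have "mset \<nu> = mset \<mu> \<longleftrightarrow> \<nu> = \<mu>" by metis
    moreover have "0 \<notin> set \<nu>" using that by (auto simp: partitions_of_def is_partition_def)
    ultimately show ?thesis by (simp add: M_mono_one g(2))
  qed
  then have "g (M_poly q r one) = (\<Sum>\<nu>\<in>partitions_of q. if \<nu> = \<mu> then scale (r \<mu>) one else 0)" for r
    unfolding M_poly_def lin_rules[OF g(1)] by (intro sum.cong) auto
  then have "g (M_poly q r one) = scale (r \<mu>) one" for r
    using assms(2) finite_partitions_of by simp
  then have "scale (s \<mu>) one = scale (t \<mu>) one" using assms(1) by metis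
  then show ?thesis using one_nonzero by simp
qed

text \<open>
  All derivatives of a vector without \<open>L\<close>s that is annihilated by the positive \<open>L n\<close> are determined by
  the derivative with respect to \<open>M (-p)\<close>, and Euler's relation, which is the action of \<open>L 0\<close>, recovers
  \<open>a - hL\<close> times the vector from them.
\<close>

lemma kernel_gradient:
  assumes x: "x \<in> pbw_span (\<lambda>A N. int (size N) < 1 \<and> (\<forall>j\<in>#A. j \<le> J))" and J: "p \<le> J"
    and pos: "\<And>n. 1 \<le> n \<Longrightarrow> n \<le> J \<Longrightarrow> L (int n) x = 0"
    and zero: "L 0 x = scale a x"
  shows "1 \<le> j \<Longrightarrow> j \<le> J \<Longrightarrow> deriv_M j x = grad_S j (deriv_M p x)"
    and "pS (deriv_M p x) = scale (a - hL) x"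
proof -
  have rows: "row J n (\<lambda>j. deriv_M j x) \<in> {0}" if "1 \<le> n" "n \<le> J" for n
    using L_nonneg_no_L[OF x, of n] pos[OF that] that by simp
  show "deriv_M j x = grad_S j (deriv_M p x)" if "1 \<le> j" "j \<le> J"
    using row_kernel(1)[OF stable_zero J rows that] by simp
  show "pS (deriv_M p x) = scale (a - hL) x"
    using row_kernel(2)[OF stable_zero J rows] L_nonneg_no_L[OF x, of 0] zero
    by (simp add: scale_left_diff_distrib)
qed

text \<open>
  Existence: \<open>pS one / p\<close> is singular, and its derivative with respect to \<open>M (-p)\<close> is \<open>one\<close>, which says
  that its coefficient at \<open>[p]\<close> is \<open>1\<close>. Uniqueness: any other candidate has the same derivative, and by
  \<open>kernel_gradient\<close> with \<open>a - hL = p\<close> it is recovered from it.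
\<close>

lemma S_eq: "S p = (\<lambda>v. scale (1 / of_nat p) (pS v))"
proof -
  have p0: "(of_nat p :: complex) \<noteq> 0" using p_pos by simp
  have "M_homogeneous p (\<lambda>v. scale (1 / of_nat p) (pS v))" by (intro M_homogeneous_scale M_homogeneous_pS)
  then obtain s where s: "\<And>\<mu>. \<mu> \<notin> partitions_of p \<Longrightarrow> s \<mu> = 0"
      "(\<lambda>v. scale (1 / of_nat p) (pS v)) = M_poly p s" by (rule M_homogeneousE) blast
  have x: "M_poly p s one = scale (1 / of_nat p) (pS one)" by (simp flip: s(2))
  have deriv_M_one: "deriv_M p one = 0" using deriv_M_pbw[of "{#}" "{#}"] by simp
  have T0: "pS 0 = 0" using lin_rules(3)[OF lin_pS] .
  have "deriv_M p (M_poly p s one) = one"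
    unfolding x using p0 by (simp add: deriv_simps deriv_M_pS deriv_M_one T0)
  then have sp: "s [p] = 1" using deriv_M_M_poly[of s] one_nonzero
    by (metis scale_one scale_right_imp_eq)
  have sing: "singular_vector (M_poly p s one)"
    unfolding singular_vector_def
  proof (intro conjI allI impI)
    show "M_poly p s one \<noteq> 0" using \<open>deriv_M p (M_poly p s one) = one\<close> one_nonzero
      by (auto simp: deriv_simps)
    show "\<exists>a. L 0 (M_poly p s one) = scale a (M_poly p s one)"
      "\<exists>a. CL (M_poly p s one) = scale a (M_poly p s one)"
      "\<exists>a. CM (M_poly p s one) = scale a (M_poly p s one)"
      using L_zero_M_poly CL_eq CM_eq by blast+
    have W1: "M_poly p s one \<in> L_filt 1" by (rule pbw_span_no_L[OF M_poly_in_pbw_span])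
    show "\<exists>a. M 0 (M_poly p s one) = scale a (M_poly p s one)"
      using M_nonneg_no_L[OF _ W1, of 0] by auto
    fix n :: int assume n: "0 < n"
    show "M n (M_poly p s one) = 0" using M_nonneg_no_L[OF _ W1, of n] n by simp
    show "L n (M_poly p s one) = 0"
      unfolding x using L_pS_one[of "nat n"] n by (simp add: act_simps)
  qed
  have uniq: "t = s" if t: "(\<forall>\<mu>. \<mu> \<notin> partitions_of p \<longrightarrow> t \<mu> = 0)" "t [p] = 1"
      "singular_vector (M_poly p t one)" for t
  proof -
    let ?x = "M_poly p t one"
    have dx: "deriv_M p ?x = one" by (simp add: deriv_M_M_poly t)
    have "pS (deriv_M p ?x) = scale (hL + of_nat p - hL) ?x"
      by (rule kernel_gradient(2)[OF M_poly_in_pbw_span order_refl _ L_zero_M_poly])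
        (use t(3) in \<open>simp add: singular_vector_def\<close>)
    then have "pS one = scale (of_nat p) ?x" by (simp add: dx)
    then have "?x = M_poly p s one" using p0 by (simp add: x)
    then have "t \<mu> = s \<mu>" for \<mu>
      using M_poly_inject[of p t s \<mu>] t(1) s(1) by (cases "\<mu> \<in> partitions_of p") auto
    then show ?thesis by blast
  qed
  have "S_coeff p = s"
    unfolding S_coeff_def
    by (rule the_equality) (use s(1) sp sing uniq in auto)
  then show ?thesis by (simp add: S_def s(2))
qed

section \<open>Singular vectors contain no factor \<open>L\<close>\<close>

text \<open>
  Euler's relation in the \<open>L\<close>s modulo lower terms: if \<open>d > 0\<close> and all \<open>L\<close>-derivatives of \<open>v\<close>
  have fewer than \<open>d - 1\<close> factors \<open>L\<close>, then \<open>v\<close> has fewer than \<open>d\<close>.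
\<close>

lemma euler_deriv_L:
  assumes "v \<in> pbw_span (\<lambda>A N. int (size N) < int d + 1 \<and> (\<forall>j\<in>#N. j \<le> J))"
  shows "(\<Sum>n\<in>{1..J}. L (- int n) (deriv_L n v)) - scale (of_nat d) v \<in> L_filt (int d)"
  using assms
proof (rule pbw_span_lin_in[where f = "\<lambda>v. (\<Sum>n\<in>{1..J}. L (- int n) (deriv_L n v)) - scale (of_nat d) v", rotated -1])
  show "lin (\<lambda>v. (\<Sum>n\<in>{1..J}. L (- int n) (deriv_L n v)) - scale (of_nat d) v)"
    by (intro lin_intros lin_compose[OF linear_L] lin_deriv_L)
  fix A N :: "nat multiset"
  assume *: "0 \<notin># A" "0 \<notin># N" and N: "int (size N) < int d + 1 \<and> (\<forall>j\<in>#N. j \<le> J)"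
  have "L (- int n) (deriv_L n (pbw A N)) - scale (of_nat (count N n)) (pbw A N) \<in> L_filt (int d)" if "n \<in> {1..J}" for n
  proof (cases "n \<in># N")
    case True
    then have eq: "add_mset n (N - {#n#}) = N" by simp
    have "L (- int n) (pbw A (N - {#n#})) - pbw A (add_mset n (N - {#n#})) \<in> L_filt (int (size (N - {#n#})) + 1)"
      using * that by (intro L_neg_pbw) (auto simp: pos_diff)
    moreover have "size (N - {#n#}) + 1 = size N" using eq by (metis size_add_mset Suc_eq_plus1)
    ultimately have "L (- int n) (pbw A (N - {#n#})) - pbw A N \<in> L_filt (int d)"
      unfolding eq using N by (intro L_filt_mono[of _ "int d"]) auto
    then have "scale (of_nat (count N n)) (L (- int n) (pbw A (N - {#n#})) - pbw A N) \<in> L_filt (int d)"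
      by (rule L_filt_closed)
    then show ?thesis using * by (simp add: deriv_L_pbw act_simps scale_right_diff_distrib)
  next
    case False
    then have "count N n = 0" by (simp add: not_in_iff)
    then show ?thesis using * by (simp add: deriv_L_pbw act_simps L_filt_closed)
  qed
  then have "(\<Sum>n\<in>{1..J}. L (- int n) (deriv_L n (pbw A N)) - scale (of_nat (count N n)) (pbw A N)) \<in> L_filt (int d)"
    by (rule L_filt_closed)
  moreover have "(\<Sum>n\<in>{1..J}. scale (of_nat (count N n)) (pbw A N)) = scale (of_nat (size N)) (pbw A N)"
  proof -
    have "size N = (\<Sum>n\<in>{1..J}. count N n)"
      unfolding size_multiset_overloaded_eq
      by (rule sum.mono_neutral_left) (use * N in \<open>auto simp: pos_mem count_eq_zero_iff\<close>)
    then show ?thesis by (simp add: scale_sum_left)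
  qed
  ultimately have "(\<Sum>n\<in>{1..J}. L (- int n) (deriv_L n (pbw A N))) - scale (of_nat (size N)) (pbw A N) \<in> L_filt (int d)"
    by (simp add: sum_subtractf)
  moreover have "scale (of_nat (size N)) (pbw A N) - scale (of_nat d) (pbw A N) \<in> L_filt (int d)"
  proof (cases "size N = d")
    case False
    then show ?thesis using * N by (intro L_filt_closed pbw_in_L_filt) auto
  qed (simp add: L_filt_closed)
  ultimately show "(\<Sum>n\<in>{1..J}. L (- int n) (deriv_L n (pbw A N))) - scale (of_nat d) (pbw A N) \<in> L_filt (int d)"
    using L_filt_closed(1) by fastforce
qed simp

text \<open>
  Suppose the leading part has \<open>d > 0\<close> factors \<open>L\<close>. Annihilation by the positive \<open>M n\<close> solves the
  triangular system for the derivatives \<open>deriv_L j v\<close> modulo lower terms; the equation for \<open>M 0\<close> then reads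
  \<open>pS (deriv_L p v) = 0\<close>, so that \<open>deriv_L p v\<close> vanishes, again modulo lower terms, by injectivity of \<open>pS\<close>.
  Hence all \<open>deriv_L j v\<close> do, and Euler's relation contradicts the choice of \<open>d\<close>.
\<close>

lemma singular_has_no_L:
  assumes "singular_vector v" shows "v \<in> L_filt 1"
proof -
  have "v \<in> pbw_span (\<lambda>A N. True)" by (simp add: pbw_span_UNIV)
  then obtain d0 where d0: "v \<in> pbw_span (\<lambda>A N. True \<and> size N \<le> d0)" by (rule pbw_span_bounded)
  have "v \<in> L_filt (int d0 + 1)"
    using d0 pbw_span_mono[of "\<lambda>A N. True \<and> size N \<le> d0" "\<lambda>A N. int (size N) < int d0 + 1"]
    by (auto simp: L_filt_def)
  define d where "d = (LEAST d. v \<in> L_filt (int d + 1))"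
  have vd: "v \<in> L_filt (int d + 1)" unfolding d_def by (rule LeastI) fact
  show ?thesis
  proof (cases "d = 0")
    case True
    with vd show ?thesis by simp
  next
    case False
    then obtain d' where d': "d = Suc d'" using not0_implies_Suc by blast
    have "v \<notin> L_filt (int d' + 1)"
      using not_less_Least[of d' "\<lambda>d. v \<in> L_filt (int d + 1)"] by (simp add: d_def[symmetric] d')
    then have notin: "v \<notin> L_filt (int d)" by (simp add: d' add.commute)
    have W0: "scale c v \<in> L_filt (int d) \<Longrightarrow> c = 0" for c
      using notin L_filt_closed(2)[of "scale c v" "int d" "inverse c"] by (cases "c = 0") auto
    obtain a where a: "M 0 v = scale a v" using assms by (auto simp: singular_vector_def)
    have "scale (a - hM) v \<in> L_filt (int d)"
      using M_nonneg_L_filt[OF _ vd, of 0] a by (simp add: scale_left_diff_distrib)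
    then have "a = hM" using W0 by fastforce
    with a have M0: "M 0 v = scale hM v" by simp
    from vd obtain J0 where "v \<in> pbw_span (\<lambda>A N. int (size N) < int d + 1 \<and> sum_mset N \<le> J0)"
      unfolding L_filt_def by (rule pbw_span_bounded)
    moreover define J where "J = max J0 p"
    ultimately have vJ: "v \<in> pbw_span (\<lambda>A N. int (size N) < int d + 1 \<and> (\<forall>j\<in>#N. j \<le> J))"
    by (elim subsetD[OF pbw_span_mono, rotated]) (auto simp: max_def dest!: mem_le_sum_mset)
    have J: "p \<le> J" by (simp add: J_def)
    let ?Z = "L_filt (int d - 1)"
    have rows: "row J n (\<lambda>j. deriv_L j v) \<in> ?Z" for n
    proof -
      have "M (int n) v - (if n = 0 then scale hM v else 0) = 0"
        using M0 assms by (simp add: singular_vector_def)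
      then have "- row J n (\<lambda>j. deriv_L j v) \<in> ?Z"
        using M_leading[OF vJ, of n] by simp
      then show ?thesis using subspace_neg[OF subspace_L_filt] by force
    qed
    have "pS (deriv_L p v) \<in> ?Z"
      using L_filt_closed(3)[OF rows[of 0] row_kernel(2)[OF stable_L_filt J rows]] by simp
    then have "deriv_L p v \<in> ?Z" by (rule pS_reflects_stable[OF stable_L_filt])
    then have "grad_S n (deriv_L p v) \<in> ?Z" for n by (rule stable_grad_S[OF stable_L_filt])
    moreover have "deriv_L n v - grad_S n (deriv_L p v) \<in> ?Z" if "n \<in> {1..J}" for n
      using row_kernel(1)[OF stable_L_filt J rows, of n] that by simp
    ultimately have "deriv_L n v \<in> ?Z" if "n \<in> {1..J}" for n
      using L_filt_closed(1)[of "deriv_L n v - grad_S n (deriv_L p v)" "int d - 1" "grad_S n (deriv_L p v)"] that by simp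
    then have "L (- int n) (deriv_L n v) \<in> L_filt (int d)" if "n \<in> {1..J}" for n
      using L_neg_L_filt[of n "deriv_L n v" "int d - 1"] that by simp
    then have "(\<Sum>n\<in>{1..J}. L (- int n) (deriv_L n v)) \<in> L_filt (int d)" by (rule L_filt_closed)
    from L_filt_closed(3)[OF this euler_deriv_L[OF vJ]] have "scale (of_nat d) v \<in> L_filt (int d)" by simp
    then show ?thesis using W0[of "of_nat d"] False by simp
  qed
qed

section \<open>Singular vectors are powers of \<open>S\<close>\<close>

text \<open>
  Euler's operator \<open>\<Sum>n. M (-n) (deriv_M n v)\<close> is diagonal in the basis with the degree as eigenvalue, so
  it is inverted off the constants by \<open>g\<close>, which divides by the degree and by \<open>1 / 0 = 0\<close> kills the
  constants.
\<close>

lemma constant_if_deriv_M_zero: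
  assumes v: "v \<in> pbw_span (\<lambda>A N. int (size N) < 1 \<and> (\<forall>j\<in>#A. j \<le> J))"
    and z: "\<And>j. 1 \<le> j \<Longrightarrow> j \<le> J \<Longrightarrow> deriv_M j v = 0"
  shows "\<exists>c. v = scale c one"
proof -
  obtain g where g: "lin g" "\<And>A N. 0 \<notin># A \<Longrightarrow> 0 \<notin># N \<Longrightarrow> g (pbw A N) = scale (1 / of_nat (size A)) (pbw A N)"
    using lin_extend[of "\<lambda>A N. scale (1 / of_nat (size A)) (pbw A N)"] by blast
  have "v - g (\<Sum>n\<in>{1..J}. M (- int n) (deriv_M n v)) \<in> span {one}"
    using v
  proof (rule pbw_span_lin_in[where f = "\<lambda>v. v - g (\<Sum>n\<in>{1..J}. M (- int n) (deriv_M n v))", rotated -1])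
    show "lin (\<lambda>v. v - g (\<Sum>n\<in>{1..J}. M (- int n) (deriv_M n v)))"
      by (intro lin_intros lin_compose[OF g(1)] lin_compose[OF linear_M] lin_deriv_M)
    fix A N :: "nat multiset"
    assume *: "0 \<notin># A" "0 \<notin># N" and N: "int (size N) < 1 \<and> (\<forall>j\<in>#A. j \<le> J)"
    have "M (- int n) (deriv_M n (pbw A N)) = scale (of_nat (count A n)) (pbw A N)" for n
      using * by (cases "n \<in># A") (auto simp: deriv_M_pbw act_simps M_pbw not_in_iff)
    moreover have "size A = (\<Sum>n\<in>{1..J}. count A n)"
      unfolding size_multiset_overloaded_eq
      by (rule sum.mono_neutral_left) (use * N in \<open>auto simp: pos_mem count_eq_zero_iff\<close>)
    ultimately have "(\<Sum>n\<in>{1..J}. M (- int n) (deriv_M n (pbw A N))) = scale (of_nat (size A)) (pbw A N)"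
      by (simp add: scale_sum_left)
    then have eq: "g (\<Sum>n\<in>{1..J}. M (- int n) (deriv_M n (pbw A N))) =
        scale (of_nat (size A) * (1 / of_nat (size A))) (pbw A N)"
      by (simp add: lin_rules[OF g(1)] g(2) *)
    show "pbw A N - g (\<Sum>n\<in>{1..J}. M (- int n) (deriv_M n (pbw A N))) \<in> span {one}"
    proof (cases "A = {#}")
      case True
      with N show ?thesis unfolding eq by (simp add: span_base)
    next
      case False
      then show ?thesis unfolding eq by (simp add: span_zero)
    qed
  qed simp
  moreover have "(\<Sum>n\<in>{1..J}. M (- int n) (deriv_M n v)) = 0" using z by (simp add: act_simps)
  ultimately have "v \<in> span {one}" by (simp only: lin_rules(3)[OF g(1)] diff_zero)
  then show ?thesis by (auto simp: span_singleton)
qed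

text \<open>
  Let \<open>w = deriv_M p v\<close>. If \<open>w = 0\<close>, all derivatives of \<open>v\<close> vanish. Otherwise \<open>w\<close> satisfies the same
  equations as \<open>v\<close>, with \<open>a - p\<close> for \<open>a\<close>, and is a multiple of a power of \<open>S\<close> by induction on the order of
  nilpotency; then \<open>(a - hL) v = pS w\<close> raises the exponent by one.
\<close>

lemma kernel_is_power:
  assumes "(deriv_M p ^^ e) v = 0" and J: "p \<le> J"
    and "v \<in> pbw_span (\<lambda>A N. int (size N) < 1 \<and> (\<forall>j\<in>#A. j \<le> J))"
    and "\<And>n. 1 \<le> n \<Longrightarrow> n \<le> J \<Longrightarrow> L (int n) v = 0"
    and "L 0 v = scale a v"
  shows "\<exists>k c. v = scale c ((S p ^^ k) one)"
  using assms(1,3,4,5)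
proof (induction e arbitrary: v a)
  case 0
  then have "v = scale 0 ((S p ^^ 0) one)" by simp
  then show ?case by blast
next
  case (Suc e)
  define w where "w = deriv_M p v"
  have grad_S_v: "deriv_M j v = grad_S j w" if "1 \<le> j" "j \<le> J" for j
    unfolding w_def by (rule kernel_gradient(1)[OF Suc.prems(2) J Suc.prems(3,4)]) (use that in auto)
  have pS_w: "pS w = scale (a - hL) v"
    unfolding w_def by (rule kernel_gradient(2)[OF Suc.prems(2) J Suc.prems(3,4)])
  show ?case
  proof (cases "w = 0")
    case True
    then have "deriv_M j v = 0" if "1 \<le> j" "j \<le> J" for j
      using grad_S_v[OF that] by (simp add: lin_rules[OF lin_grad_S])
    from constant_if_deriv_M_zero[OF Suc.prems(2) this] obtain c where "v = scale c ((S p ^^ 0) one)"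
      by auto
    then show ?thesis by blast
  next
    case False
    have w: "w \<in> pbw_span (\<lambda>A N. int (size N) < 1 \<and> (\<forall>j\<in>#A. j \<le> J))"
      unfolding w_def
      by (rule pbw_span_lin_in[OF lin_deriv_M subspace_pbw_span _ Suc.prems(2)])
        (auto simp: deriv_M_pbw pos_diff intro!: subspace_scale[OF subspace_pbw_span] pbw_in_span dest: in_diffD)
    have dw: "deriv_M j w = grad_S j (deriv_M p w)" if "1 \<le> j" "j \<le> J" for j
      using grad_S_v[OF that] deriv_M_grad_S[OF that(1), of w] deriv_M_commute[of j p v] by (simp add: w_def)
    have roww: "row J n (\<lambda>j. deriv_M j w) = row J n (\<lambda>j. grad_S j (deriv_M p w))" if "n \<le> J" for n
      by (rule row_cong) (use dw that in auto)
    have Lw: "L (int n) w = 0" if "1 \<le> n" "n \<le> J" for n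
      using L_nonneg_no_L[OF w, of n] roww[OF that(2)] row_grad_S[OF that(1) J] that by simp
    have "scale (a - hL) w = deriv_M p (pS w)" unfolding pS_w by (simp add: deriv_simps w_def)
    also have "\<dots> = pS (deriv_M p w) + scale (of_nat p) w" by (rule deriv_M_pS)
    finally have Tw: "pS (deriv_M p w) = scale (a - hL) w - scale (of_nat p) w" by simp
    have "L 0 w = scale hL w + pS (deriv_M p w)"
      using L_nonneg_no_L[OF w, of 0] roww[of 0] row_grad_S_bound[OF J] by (simp add: pS_def)
    then have L0w: "L 0 w = scale (a - of_nat p) w"
      unfolding Tw by (simp add: scale_left_diff_distrib)
    have "(deriv_M p ^^ e) w = 0"
      using Suc.prems(1) by (simp add: w_def funpow_Suc_right del: funpow.simps)
    from Suc.IH[OF this w Lw L0w] obtain k c where kc: "w = scale c ((S p ^^ k) one)" by blast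
    \<comment> \<open>Otherwise \<open>pS w = 0\<close>, and \<open>pS\<close> is injective.\<close>
    have "a \<noteq> hL"
    proof
      assume "a = hL"
      then have "pS w \<in> {0}" using pS_w by simp
      then have "w \<in> {0}" by (rule pS_reflects_stable[OF stable_zero])
      with False show False by simp
    qed
    then have "v = scale (1 / (a - hL)) (pS w)" unfolding pS_w by simp
    also have "\<dots> = scale (c * of_nat p / (a - hL)) ((S p ^^ Suc k) one)"
      using p_pos by (simp add: kc lin_rules[OF lin_pS] S_eq)
    finally show ?thesis by blast
  qed
qed

lemma singular_is_power:
  assumes "singular_vector v"
  shows "\<exists>k a. v = scale a ((S p ^^ k) one)"
proof -
  have "v \<in> L_filt 1" using assms by (rule singular_has_no_L)
  then obtain J0 where "v \<in> pbw_span (\<lambda>A N. int (size N) < 1 \<and> sum_mset A \<le> J0)"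
    unfolding L_filt_def by (rule pbw_span_bounded)
  moreover define J where "J = max J0 p"
  ultimately have vJ: "v \<in> pbw_span (\<lambda>A N. int (size N) < 1 \<and> (\<forall>j\<in>#A. j \<le> J))"
    by (elim subsetD[OF pbw_span_mono, rotated]) (auto simp: max_def dest!: mem_le_sum_mset)
  obtain e where e: "(deriv_M p ^^ e) v = 0" using deriv_M_locally_nilpotent by blast
  obtain a where a: "L 0 v = scale a v" using assms by (auto simp: singular_vector_def)
  show ?thesis
    by (rule kernel_is_power[OF e _ vJ _ a])
      (use assms in \<open>auto simp: J_def singular_vector_def\<close>)
qed

end

theorem corollary3p19:
  fixes scale :: "complex \<Rightarrow> 'v::ab_group_add \<Rightarrow> 'v"
    and L M :: "int \<Rightarrow> 'v \<Rightarrow> 'v" and CL CM :: "'v \<Rightarrow> 'v"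
    and hL hM cL cM :: complex and one v :: 'v and p :: nat
  assumes "W22_Verma scale L M CL CM hL hM cL cM one"
    and "cM \<noteq> 0"
    and "p \<ge> 1"
    and "2 * hM + (of_nat p ^ 2 - 1) / 12 * cM = 0"
    and "W22_module.singular_vector scale L M CL CM v"
  shows "\<exists>(k::nat) (a::complex). v = scale a ((W22_Verma.S scale L M CL CM one p ^^ k) one)"
proof -
  interpret W22_Verma scale L M CL CM hL hM cL cM one by fact
  interpret W22_Verma_atypical scale L M CL CM hL hM cL cM one p
    using assms by unfold_locales auto
  show ?thesis using assms(5) by (rule singular_is_power)
qed

end
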